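(* Every irreducible self-representation (group homomorphism) $\varrho\colon\mathrm{Is}(\mathbf{H}^\infty)\to\mathrm{Is}(\mathbf{H}^\infty)$ is continuous.
   Context: Let $H$ be a separable infinite-dimensional real Hilbert space and let $B$ be the bilinear form on $\mathbf{R}\oplus H$ given by $B(s\oplus h,s'\oplus h')=ss'-\langle h,h'\rangle$. The infinite-dimensional real hyperbolic space is $\mathbf{H}^\infty=\{x=s\oplus h: B(x,x)=1,\ s>0\}$ with metric $d$ given by $\cosh d(x,y)=B(x,y)$. Its isometry group $\mathrm{Is}(\mathbf{H}^\infty)$ is endowed with the (Polish) topology of pointwise convergence. Every isometry of $\mathbf{H}^\infty$ is the restriction of a unique invertible linear operator of $\mathbf{R}\oplus H$ preserving $B$ and $\mathbf{H}^\infty$, so $\mathrm{Is}(\mathbf{H}^\infty)\cong \mathbf{O}_+(B)$. A representation $G\to \mathrm{Is}(\mathbf{H}^\infty)$ is irreducible if the associated linear representation on $\mathbf{R}\oplus H$ has no closed invariant linear subspaces other than $0$ and the whole space. *)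

theory Defs
  imports "HOL-Analysis.Analysis" "HOL-Algebra.Bij"
begin

section \<open>The hyperboloid model\<close>

definition lform :: "real \<times> 'h::real_inner \<Rightarrow> real \<times> 'h \<Rightarrow> real"
  where "lform x y = fst x * fst y - inner (snd x) (snd y)"

definition hyp :: "(real \<times> 'h::real_inner) set"
  where "hyp = {x. lform x x = 1 \<and> fst x > 0}"

text \<open>The value \<open>0\<close> off the hyperboloid is a dummy: \<^locale>\<open>Metric_space\<close> demands
  symmetry and nonnegativity on the whole type.\<close>

definition hdist :: "real \<times> 'h::real_inner \<Rightarrow> real \<times> 'h \<Rightarrow> real"
  where "hdist x y = (if x \<in> hyp \<and> y \<in> hyp then arcosh (lform x y) else 0)"

definition hyp_topology :: "(real \<times> 'h::real_inner) topology"
  where "hyp_topology = Metric_space.mtopology hyp hdist"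

section \<open>The isometry group\<close>

text \<open>Members of \<^term>\<open>Bij S\<close> are extensional, that is, they are \<^const>\<open>undefined\<close>
  outside of \<open>S\<close>, so that they correspond exactly to the self-bijections of \<open>S\<close>.\<close>

definition hyp_isometries :: "(real \<times> 'h::real_inner \<Rightarrow> real \<times> 'h) set"
  where "hyp_isometries =
    {f \<in> Bij hyp. \<forall>x\<in>hyp. \<forall>y\<in>hyp. hdist (f x) (f y) = hdist x y}"

definition Is_group :: "(real \<times> 'h::real_inner \<Rightarrow> real \<times> 'h) monoid"
  where "Is_group = (BijGroup hyp)\<lparr>carrier := hyp_isometries\<rparr>"

text \<open>Pointwise convergence, as a subspace of the product of copies of the hyperboloid
  indexed by its points.\<close>

definition Is_topology :: "(real \<times> 'h::real_inner \<Rightarrow> real \<times> 'h) topology"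
  where "Is_topology =
    subtopology (product_topology (\<lambda>_. hyp_topology) hyp) hyp_isometries"

section \<open>Irreducibility\<close>

definition is_linear_ext ::
    "(real \<times> 'h::real_inner \<Rightarrow> real \<times> 'h) \<Rightarrow> (real \<times> 'h \<Rightarrow> real \<times> 'h) \<Rightarrow> bool"
  where "is_linear_ext f L \<longleftrightarrow>
    linear L \<and> bij L \<and> (\<forall>x y. lform (L x) (L y) = lform x y) \<and> L ` hyp = hyp
    \<and> (\<forall>x\<in>hyp. L x = f x)"

definition linear_ext ::
    "(real \<times> 'h::real_inner \<Rightarrow> real \<times> 'h) \<Rightarrow> real \<times> 'h \<Rightarrow> real \<times> 'h"
  where "linear_ext f = (THE L. is_linear_ext f L)"

definition irreducible_rep ::
    "('g, 'b) monoid_scheme \<Rightarrow> ('g \<Rightarrow> real \<times> 'h::real_inner \<Rightarrow> real \<times> 'h) \<Rightarrow> bool"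
  where "irreducible_rep G \<rho> \<longleftrightarrow>
    (\<forall>V. subspace V \<and> closed V \<and> (\<forall>g\<in>carrier G. linear_ext (\<rho> g) ` V \<subseteq> V)
      \<longrightarrow> V = {0} \<or> V = UNIV)"

section \<open>Well-definedness\<close>

lemma lform_commute: "lform x y = lform y x"
  by (simp add: lform_def inner_commute mult.commute)

lemma bilinear_lform: "bilinear lform"
  unfolding bilinear_def lform_def
  by (auto intro!: linearI simp: algebra_simps)

lemma linear_lform_left: "linear (\<lambda>x. lform x y)"
  using bilinear_lform unfolding bilinear_def by blast

lemma linear_lform_right: "linear (lform x)"
  using bilinear_lform unfolding bilinear_def by blast

lemmas lform_simps =
  bilinear_ladd[OF bilinear_lform] bilinear_radd[OF bilinear_lform]
  bilinear_lsub[OF bilinear_lform] bilinear_rsub[OF bilinear_lform]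
  bilinear_lmul[OF bilinear_lform] bilinear_rmul[OF bilinear_lform]

lemma fst_hyp:
  assumes "x \<in> hyp" shows "fst x = sqrt (1 + (norm (snd x))\<^sup>2)"
proof -
  have "(fst x)\<^sup>2 = 1 + (norm (snd x))\<^sup>2" "fst x > 0"
    using assms by (auto simp: hyp_def lform_def power2_eq_square[of "fst x"] dot_square_norm)
  then show ?thesis
    by (metis less_le real_sqrt_unique)
qed

lemma hypI: "(sqrt (1 + (norm h)\<^sup>2), h) \<in> hyp"
proof -
  have "0 < 1 + (norm h)\<^sup>2"
    by (simp add: add_pos_nonneg)
  then show ?thesis
    by (simp add: hyp_def lform_def dot_square_norm flip: power2_eq_square)
qed

lemma sqrt_prod_ge: "sqrt (1 + a\<^sup>2) * sqrt (1 + b\<^sup>2) \<ge> 1 + a * b" for a b :: real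
proof -
  have "(1 + a * b)\<^sup>2 \<le> (1 + a\<^sup>2) * (1 + b\<^sup>2)"
    using zero_le_power2[of "a - b"] by (simp add: power2_eq_square algebra_simps)
  then show ?thesis
    by (metis real_le_rsqrt real_sqrt_mult)
qed

lemma lform_ge_1:
  assumes "x \<in> hyp" "y \<in> hyp" shows "lform x y \<ge> 1"
  using sqrt_prod_ge[of "norm (snd x)" "norm (snd y)"] norm_cauchy_schwarz[of "snd x" "snd y"]
  by (simp add: lform_def fst_hyp assms)

lemma lform_orth_nonpos:
  assumes y: "y \<in> hyp" and v: "lform v y = 0" shows "lform v v \<le> 0"
proof -
  let ?t = "fst y" let ?k = "norm (snd y)"
  have t: "?t > 0" "?t\<^sup>2 = 1 + ?k\<^sup>2"
    using y by (auto simp: hyp_def lform_def power2_eq_square[of "fst y"] dot_square_norm)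
  have "\<bar>fst v * ?t\<bar> \<le> norm (snd v) * ?k"
    using v Cauchy_Schwarz_ineq2[of "snd v" "snd y"] by (simp add: lform_def)
  also have "\<dots> \<le> norm (snd v) * ?t"
    using t by (intro mult_left_mono) (auto intro: power2_le_imp_le)
  finally have "\<bar>fst v\<bar> \<le> norm (snd v)"
    using t by (simp add: abs_mult)
  then have "(fst v)\<^sup>2 \<le> (norm (snd v))\<^sup>2"
    by (metis abs_ge_zero power2_abs power_mono)
  then show ?thesis
    by (simp add: lform_def dot_square_norm flip: power2_eq_square)
qed

lemma lform_eq_1_iff:
  assumes "x \<in> hyp" "y \<in> hyp" shows "lform x y = 1 \<longleftrightarrow> x = y"
proof
  assume eq: "lform x y = 1"
  let ?a = "norm (snd x)" let ?b = "norm (snd y)"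
  have xx: "lform x x = 1" and yy: "lform y y = 1"
    using assms by (auto simp: hyp_def)
  let ?s = "fst x" let ?t = "fst y"
  have "?s * ?t = 1 + inner (snd x) (snd y)"
    using eq by (simp add: lform_def)
  have ge: "1 + ?a * ?b \<le> ?s * ?t"
    using sqrt_prod_ge by (simp add: fst_hyp assms)
  have "inner (snd x) (snd y) \<le> ?a * ?b"
    by (rule norm_cauchy_schwarz)
  then have in_eq: "inner (snd x) (snd y) = ?a * ?b" "?s * ?t = 1 + ?a * ?b"
    using ge \<open>?s * ?t = _\<close> by linarith+
  have s2: "?s\<^sup>2 = 1 + ?a\<^sup>2" "?t\<^sup>2 = 1 + ?b\<^sup>2"
    using xx yy by (auto simp: lform_def power2_eq_square[of "fst _"] dot_square_norm)
  have "(?s * ?t)\<^sup>2 = (1 + ?a\<^sup>2) * (1 + ?b\<^sup>2)"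
    by (simp add: power_mult_distrib s2)
  then have "(?a - ?b)\<^sup>2 = 0"
    unfolding in_eq(2) by (simp add: power2_eq_square algebra_simps)
  then have ab: "?a = ?b" by simp
  then have "(norm (snd x - snd y))\<^sup>2 = 0"
    using in_eq(1)
    by (simp add: dot_norm_neg power2_eq_square)
  then have "snd x = snd y" by simp
  then show "x = y"
    using fst_hyp[OF assms(1)] fst_hyp[OF assms(2)] by (simp add: prod_eq_iff)
next
  assume "x = y" then show "lform x y = 1" using assms by (simp add: hyp_def)
qed

lemma lform_triangle:
  assumes x: "x \<in> hyp" and y: "y \<in> hyp" and z: "z \<in> hyp" and ne: "z \<noteq> y"
  shows "lform x z \<le> lform x y * lform y z + sqrt ((lform x y)\<^sup>2 - 1) * sqrt ((lform y z)\<^sup>2 - 1)"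
proof -
  define p q where "p = lform x y" and "q = lform y z"
  define u w where "u = x - p *\<^sub>R y" and "w = z - q *\<^sub>R y"
  have 1: "lform x x = 1" "lform y y = 1" "lform z z = 1"
    using x y z by (auto simp: hyp_def)
  have comm: "lform y x = p" "lform z y = q" "lform x y = p" "lform y z = q" "lform z x = lform x z"
    by (simp_all add: p_def q_def lform_commute)
  have uw: "lform u y = 0" "lform w y = 0" "lform u u = 1 - p\<^sup>2" "lform w w = 1 - q\<^sup>2"
      "lform u w = lform x z - p * q" "lform w u = lform x z - p * q"
    by (simp_all add: u_def w_def lform_simps 1 comm power2_eq_square algebra_simps)
  define A C D where "A = p\<^sup>2 - 1" and "C = q\<^sup>2 - 1" and "D = lform x z - p * q"
  have "q \<ge> 1" "q \<noteq> 1"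
    using lform_ge_1[OF y z] lform_eq_1_iff[OF y z] ne by (auto simp: q_def)
  then have C: "C > 0"
    by (simp add: C_def one_less_power)
  have "p \<ge> 1"
    using lform_ge_1[OF x y] by (auto simp: p_def)
  then have A: "A \<ge> 0"
    by (simp add: A_def)
  let ?v = "C *\<^sub>R u + D *\<^sub>R w"
  have "lform ?v y = 0"
    by (simp add: lform_simps uw)
  then have "lform ?v ?v \<le> 0"
    by (rule lform_orth_nonpos[OF y])
  moreover have "lform ?v ?v = C * (D\<^sup>2 - A * C)"
    by (simp add: lform_simps uw A_def C_def D_def power2_eq_square algebra_simps)
  ultimately have "D\<^sup>2 \<le> A * C"
    using C by (simp add: mult_le_0_iff)
  then have "D \<le> sqrt A * sqrt C"
    by (metis real_le_rsqrt real_sqrt_mult)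
  then show ?thesis
    by (simp add: comm A_def C_def D_def)
qed

lemma cosh_hdist: "x \<in> hyp \<Longrightarrow> y \<in> hyp \<Longrightarrow> cosh (hdist x y) = lform x y"
  by (simp add: hdist_def lform_ge_1)

lemma Metric_space_hyp: "Metric_space (hyp :: (real \<times> 'h::real_inner) set) hdist"
proof
  fix x y z :: "real \<times> 'h"
  show nn: "0 \<le> hdist x y" for x y :: "real \<times> 'h"
    by (simp add: hdist_def lform_ge_1)
  show "hdist x y = hdist y x"
    by (simp add: hdist_def lform_commute)
  show zero: "hdist x y = 0 \<longleftrightarrow> x = y" if "x \<in> hyp" "y \<in> hyp" for x y :: "real \<times> 'h"
    using that by (simp add: hdist_def lform_ge_1 lform_eq_1_iff)
  show "hdist x z \<le> hdist x y + hdist y z" if *: "x \<in> hyp" "y \<in> hyp" "z \<in> hyp"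
  proof (cases "z = y")
    case True
    then show ?thesis using nn by simp
  next
    case False
    have "cosh (hdist x z) \<le> cosh (hdist x y + hdist y z)"
      using lform_triangle[OF * False] *
      by (simp add: cosh_add cosh_hdist) (simp add: hdist_def sinh_arcosh_real lform_ge_1)
    then show ?thesis
      using nn by (simp add: cosh_real_nonneg_le_iff)
  qed
qed

lemma subgroup_hyp_isometries: "subgroup hyp_isometries (BijGroup hyp)"
proof -
  interpret group "BijGroup hyp" by (rule group_BijGroup)
  show ?thesis
  proof (rule subgroupI)
    show "hyp_isometries \<subseteq> carrier (BijGroup hyp)"
      by (auto simp: hyp_isometries_def BijGroup_def)
    have "(\<lambda>x\<in>hyp. x) \<in> hyp_isometries"
      by (simp add: hyp_isometries_def id_Bij)
    then show "hyp_isometries \<noteq> {}" by blast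
  next
    fix f assume f: "f \<in> hyp_isometries"
    then have fB: "f \<in> Bij hyp" by (simp add: hyp_isometries_def)
    let ?g = "\<lambda>x\<in>hyp. inv_into hyp f x"
    have "hdist (?g x) (?g y) = hdist x y" if "x \<in> hyp" "y \<in> hyp" for x y
    proof -
      have "f ` hyp = hyp"
        using fB by (simp add: Bij_def bij_betw_def)
      then have "?g x \<in> hyp" "?g y \<in> hyp" "f (?g x) = x" "f (?g y) = y"
        using that by (auto simp: inv_into_into f_inv_into_f)
      then show ?thesis
        using f unfolding hyp_isometries_def by (metis (mono_tags, lifting) mem_Collect_eq)
    qed
    then show "inv\<^bsub>BijGroup hyp\<^esub> f \<in> hyp_isometries"
      using restrict_inv_into_Bij[OF fB] inv_BijGroup[OF fB] by (simp add: hyp_isometries_def)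
  next
    fix f g :: "real \<times> 'a \<Rightarrow> real \<times> 'a"
    assume f: "f \<in> hyp_isometries" and g: "g \<in> hyp_isometries"
    then have "f \<in> Bij hyp" "g \<in> Bij hyp" by (auto simp: hyp_isometries_def)
    then have "f \<otimes>\<^bsub>BijGroup hyp\<^esub> g = compose hyp f g" "compose hyp f g \<in> Bij hyp" "g \<in> hyp \<rightarrow> hyp"
      by (auto simp: BijGroup_def compose_Bij Bij_imp_funcset)
    then show "f \<otimes>\<^bsub>BijGroup hyp\<^esub> g \<in> hyp_isometries"
      using f g by (auto simp: hyp_isometries_def compose_eq Pi_iff)
  qed
qed

lemma group_Is_group: "group Is_group"
  unfolding Is_group_def
  by (rule subgroup.subgroup_is_group[OF subgroup_hyp_isometries group_BijGroup])

lemma topspace_Is_topology: "topspace Is_topology = carrier Is_group"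
proof -
  have "hyp_isometries \<subseteq> (\<Pi>\<^sub>E x\<in>hyp. hyp)"
    by (auto simp: hyp_isometries_def Bij_def PiE_def dest!: bij_betw_imp_funcset)
  then show ?thesis
    by (auto simp: Is_topology_def Is_group_def hyp_topology_def
        Metric_space.topspace_mtopology[OF Metric_space_hyp])
qed

lemma span_hyp: "span hyp = (UNIV :: (real \<times> 'h::real_inner) set)"
proof -
  have "x \<in> span hyp" for x :: "real \<times> 'h"
  proof -
    let ?y = "(sqrt (1 + (norm (snd x))\<^sup>2), snd x)"
    have "(1, 0) \<in> (hyp :: (real \<times> 'h) set)"
      using hypI[of "0 :: 'h"] by simp
    then have "?y + (fst x - sqrt (1 + (norm (snd x))\<^sup>2)) *\<^sub>R (1, 0) \<in> span hyp"
      by (intro span_add span_mul span_base hypI)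
    then show ?thesis by simp
  qed
  then show ?thesis by auto
qed

lemma lform_nondegenerate:
  assumes "\<And>y. y \<in> hyp \<Longrightarrow> lform v y = 0" shows "v = 0"
proof -
  have "lform v y = 0" for y
    using linear_eq_on_span[OF linear_lform_right linear_zero, of hyp v y] assms span_hyp by auto
  from this[of "(fst v, - snd v)"] have "(fst v)\<^sup>2 + (norm (snd v))\<^sup>2 = 0"
    by (simp add: lform_def dot_square_norm flip: power2_eq_square)
  then show ?thesis
    by (simp add: prod_eq_iff sum_power2_eq_zero_iff)
qed

lemma ex1_linear_ext:
  fixes f :: "real \<times> 'a::real_inner \<Rightarrow> real \<times> 'a"
  assumes "f \<in> hyp_isometries" shows "\<exists>!L. is_linear_ext f L"
proof (rule ex_ex1I)
  have f: "f ` hyp = hyp" "\<And>x y. x \<in> hyp \<Longrightarrow> y \<in> hyp \<Longrightarrow> lform (f x) (f y) = lform x y"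
  proof -
    show fh: "f ` hyp = hyp"
      using assms by (simp add: hyp_isometries_def Bij_def bij_betw_def)
    fix x y :: "real \<times> 'a" assume *: "x \<in> hyp" "y \<in> hyp"
    then have "f x \<in> hyp" "f y \<in> hyp" "hdist (f x) (f y) = hdist x y"
      using assms fh by (auto simp: hyp_isometries_def)
    then show "lform (f x) (f y) = lform x y"
      using * by (metis cosh_hdist)
  qed
  obtain b :: "(real \<times> 'a) set" where b: "b \<subseteq> hyp" "independent b" "hyp \<subseteq> span b"
    using maximal_independent_subset[of hyp] by blast
  have sb: "span b = UNIV"
    by (metis b(1) b(3) span_hyp span_mono span_span subset_antisym)
  obtain L where L: "linear L" "\<And>x. x \<in> b \<Longrightarrow> L x = f x"
    using linear_independent_extend[OF b(2), of f] by blast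
  have 1: "lform (L x) (f y) = lform x y" if "y \<in> hyp" for x y
  proof (rule linear_eq_on_span[where B = b and f = "\<lambda>x. lform (L x) (f y)" and g = "\<lambda>x. lform x y"])
    show "linear (\<lambda>x. lform (L x) (f y))"
      using linear_compose[OF L(1) linear_lform_left] by (simp add: o_def)
    show "linear (\<lambda>x. lform x y)" by (rule linear_lform_left)
    show "lform (L x) (f y) = lform x y" if "x \<in> b" for x
      using that \<open>y \<in> hyp\<close> b(1) f(2)[of x y] L(2)[of x] by auto
  qed (simp add: sb)
  have Lf: "L x = f x" if "x \<in> hyp" for x
  proof -
    have "lform (L x - f x) z = 0" if z: "z \<in> hyp" for z
    proof -
      obtain y where "y \<in> hyp" "z = f y" using f(1) z by blast
      then show ?thesis using 1 f(2) \<open>x \<in> hyp\<close> by (simp add: lform_simps)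
    qed
    then show ?thesis using lform_nondegenerate[of "L x - f x"] by simp
  qed
  have 2: "lform (L x) (L y) = lform x y" for x y
  proof (rule linear_eq_on_span[where B = hyp and f = "\<lambda>y. lform (L x) (L y)" and g = "lform x"])
    show "linear (\<lambda>y. lform (L x) (L y))"
      using linear_compose[OF L(1) linear_lform_right] by (simp add: o_def)
    show "linear (lform x)" by (rule linear_lform_right)
    show "lform (L x) (L y) = lform x y" if "y \<in> hyp" for y
      using 1 Lf that by simp
  qed (simp add: span_hyp)
  have "inj L"
  proof (subst linear_injective_0[OF L(1)], intro allI impI)
    fix x assume "L x = 0"
    then have "lform x y = 0" for y
      using 2[of x y] bilinear_lzero[OF bilinear_lform, of "L y"] by simp
    then show "x = 0" by (rule lform_nondegenerate)
  qed
  have Lh: "L ` hyp = hyp"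
    using Lf f(1) by (simp cong: image_cong)
  have "surj L"
    using linear_span_image[OF L(1), of hyp] by (simp add: Lh span_hyp)
  then show "\<exists>L. is_linear_ext f L"
    unfolding is_linear_ext_def bij_def using \<open>inj L\<close> L(1) 2 Lh Lf by blast
next
  fix L L' :: "real \<times> 'a \<Rightarrow> real \<times> 'a"
  assume "is_linear_ext f L" "is_linear_ext f L'"
  then have "linear L" "linear L'" "\<forall>x\<in>hyp. L x = L' x"
    by (auto simp: is_linear_ext_def)
  then show "L = L'"
    using linear_eq_on_span[of L L' hyp] by (simp add: fun_eq_iff span_hyp)
qed

end

theory Submission
  imports Defs
begin

text \<open>Let \<open>K\<close> be the stabilizer of the base point \<open>(1, 0)\<close> in the isometry group; it is the orthogonal
  group of the Hilbert space \<open>H\<close>, as an abstract group. The proof never shows that \<open>\<rho>\<close> is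
  continuous on \<open>K\<close> first. It rests on three facts.

  (1) \<open>\<rho>(K)\<close> fixes a point. The function \<open>l(U) = d(\<rho>(U) o, o)\<close> is a length function on the
  orthogonal group, and every length function on it is bounded (\<open>length_bounded\<close>). Indeed,
  write \<open>H\<close> as a Hilbert sum of copies of itself indexed by \<open>\<int>\<^sup>2\<close>. Given any sequence \<open>g\<^sub>n\<close> of
  orthogonal operators, three fixed operators and their inverses suffice to express, for each \<open>n\<close>, the operator that
  acts as \<open>g\<^sub>n\<close> on the copy at the origin and trivially on the others, by a word whose length grows
  linearly in \<open>n\<close> (\<open>commutator_trick\<close>). As the sequence is arbitrary, \<open>l\<close> is bounded on the
  operators supported on one copy, hence on the pointwise stabilizer of any orthonormal family with
  infinite-dimensional orthogonal complement (\<open>bounded_on_stabilizer\<close>). Finally the whole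
  orthogonal group is a product of four such stabilizers. So \<open>\<rho>(K)\<close> has a bounded orbit, and the
  circumcenter of that orbit (\<open>circumcenter\<close>) is a fixed point \<open>p\<close>.

  (2) By (1), \<open>g o \<mapsto> \<rho>(g) p\<close> is a well-defined equivariant map \<open>f\<close> of the hyperbolic space into
  itself, and as the space is two-point homogeneous, \<open>d(f x, f y)\<close> depends on \<open>d(x, y)\<close> only. Such a
  map is automatically continuous (\<open>distance_determined_continuous\<close>): the hyperbolic space is
  uncountable and separable, so for each \<open>\<epsilon>\<close> some two distinct points \<open>x\<close>, \<open>y\<close> have
  \<open>d(f x, f y) < \<epsilon>\<close>. Two points at distance at most \<open>d(x, y)\<close> are both at distance
  \<open>d(x, y)\<close> from some third point, so their images are at distance less than \<open>2\<epsilon>\<close>.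

  (3) Let \<open>C\<close> be the set of the vectors \<open>v\<close> of \<open>\<real> \<oplus> H\<close> for which the orbit map \<open>g \<mapsto> \<rho>(g) v\<close> is
  continuous, where \<open>\<rho>(g)\<close> acts by its linear extension. It is an invariant linear subspace. By (2)
  it contains \<open>p\<close>, which bounds the operator norm of \<open>\<rho>(g)\<close> locally and makes \<open>C\<close> closed.
  Irreducibility then gives \<open>C = \<real> \<oplus> H\<close>, which is the claim.\<close>

section \<open>Orthonormal families and orthogonal operators\<close>

text \<open>Families rather than sets, so that the vectors of an orthonormal family are pairwise distinct.\<close>

definition orthonormal :: "('i \<Rightarrow> 'a::real_inner) \<Rightarrow> bool"
  where "orthonormal e \<longleftrightarrow> (\<forall>i j. inner (e i) (e j) = of_bool (i = j))"

text \<open>An orthonormal family with this property is a Hilbert basis.\<close>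

definition complete_fam :: "('i \<Rightarrow> 'a::real_inner) \<Rightarrow> bool"
  where "complete_fam e \<longleftrightarrow> closure (span (range e)) = UNIV"

text \<open>Linear isometric embeddings, not necessarily onto.\<close>

definition lin_isom :: "('a::real_inner \<Rightarrow> 'b::real_inner) \<Rightarrow> bool"
  where "lin_isom U \<longleftrightarrow> linear U \<and> (\<forall>x. norm (U x) = norm x)"

text \<open>The orthogonal group of a Hilbert space, as a set of maps.\<close>

definition orth_group :: "('a::real_inner \<Rightarrow> 'a) set"
  where "orth_group = {U. lin_isom U \<and> surj U}"

text \<open>The principle by which identities are extended from a Hilbert basis to the whole space.\<close>

lemma complete_fam_induct:
  assumes "complete_fam e" "subspace V" "closed V" "\<And>i. e i \<in> V"
  shows "x \<in> V"
proof -
  have "span (range e) \<subseteq> V"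
    using assms(2,4) by (intro span_minimal) auto
  then have "closure (span (range e)) \<subseteq> V"
    using assms(3) by (rule closure_minimal)
  then show ?thesis
    using assms(1) by (auto simp: complete_fam_def)
qed

lemma lin_isom_linear: "lin_isom U \<Longrightarrow> linear U"
  and lin_isom_norm: "lin_isom U \<Longrightarrow> norm (U x) = norm x"
  by (auto simp: lin_isom_def)

lemma lin_isom_inner:
  assumes "lin_isom U" shows "inner (U x) (U y) = inner x y"
proof -
  have "norm (U x + U y) = norm (x + y)"
    using assms by (metis lin_isom_linear lin_isom_norm linear_add)
  then show ?thesis
    using assms by (simp add: dot_norm lin_isom_norm)
qed

lemma lin_isom_bounded_linear: "lin_isom U \<Longrightarrow> bounded_linear U"
  by (intro bounded_linear_intro[where K = 1])
    (auto simp: lin_isom_norm linear_add lin_isom_linear linear_scale)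

lemma lin_isom_continuous: "lin_isom U \<Longrightarrow> continuous_on S U"
  by (meson lin_isom_bounded_linear linear_continuous_on)

lemma lin_isom_inj: "lin_isom U \<Longrightarrow> inj U"
  using linear_injective_0[OF lin_isom_linear] lin_isom_norm[of U]
  by (metis (no_types) norm_eq_zero)

lemma lin_isom_compose: "lin_isom U \<Longrightarrow> lin_isom V \<Longrightarrow> lin_isom (U \<circ> V)"
  by (auto simp: lin_isom_def linear_compose)

lemma lin_isom_id: "lin_isom id"
  by (simp add: lin_isom_def linear_id)

lemma closed_eq_set:
  fixes U V :: "'a::real_inner \<Rightarrow> 'b::real_inner"
  assumes "lin_isom U" "lin_isom V"
  shows "closed {x. U x = V x}" "subspace {x. U x = V x}"
proof -
  show "closed {x. U x = V x}"
    using assms by (intro closed_Collect_eq lin_isom_continuous)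
  show "subspace {x. U x = V x}"
    using assms[THEN lin_isom_linear]
    by (auto simp: subspace_def linear_0 linear_add linear_scale)
qed

lemma lin_isom_eqI:
  assumes "complete_fam e" "lin_isom U" "lin_isom V" "\<And>i. U (e i) = V (e i)"
  shows "U = V"
  using complete_fam_induct[OF assms(1) closed_eq_set(2,1)[OF assms(2,3)]] assms(4) by auto

lemma closed_orth: "closed {x. inner x y = 0}" "subspace {x. inner x y = 0}"
  by (auto intro!: closed_Collect_eq continuous_intros simp: subspace_def inner_left_distrib)

lemma complete_fam_orth:
  assumes "complete_fam e" "\<And>i. inner (e i) y = 0" shows "y = 0"
proof -
  have "inner y y = 0"
    using complete_fam_induct[OF assms(1) closed_orth(2,1)] assms(2) by auto
  then show ?thesis by simp
qed

text \<open>Orthogonal projection onto a closed subspace: by the parallelogram law, a sequence in the subspace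
  that minimizes the distance to \<open>x\<close> is a Cauchy sequence, and its limit is the projection.\<close>

lemma closed_subspace_decomp:
  fixes V :: "'a::{real_inner,complete_space} set"
  assumes V: "subspace V" "closed V"
  obtains v where "v \<in> V" "\<And>w. w \<in> V \<Longrightarrow> inner (x - v) w = 0"
proof -
  have ne: "V \<noteq> {}" using V(1) subspace_0 by blast
  define d where "d = infdist x V"
  have d0: "d \<ge> 0" by (simp add: d_def infdist_nonneg)
  have "\<exists>v\<in>V. dist x v < d + 1 / Suc n" for n
  proof -
    have "(INF a\<in>V. dist x a) < d + 1 / Suc n"
      using ne by (simp add: d_def infdist_def)
    then show ?thesis
      using ne cINF_less_iff[of V "dist x"] by (auto intro!: bdd_belowI[where m = 0])
  qed
  then obtain v where v: "\<And>n. v n \<in> V" "\<And>n. dist x (v n) < d + 1 / Suc n"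
    by metis
  have dle: "d \<le> dist x w" if "w \<in> V" for w
    using that by (simp add: d_def infdist_le)
  define a where "a n = (d + 1 / Suc n)\<^sup>2" for n
  have alim: "a \<longlonglongrightarrow> d\<^sup>2"
  proof -
    have "(\<lambda>n. (d + 1 / Suc n)\<^sup>2) \<longlonglongrightarrow> (d + 0)\<^sup>2"
      by (intro tendsto_intros LIMSEQ_Suc[OF lim_1_over_n])
    moreover have "a = (\<lambda>n. (d + 1 / Suc n)\<^sup>2)"
      by (simp add: a_def fun_eq_iff)
    ultimately show ?thesis by simp
  qed
  have par: "(dist (v n) (v m))\<^sup>2 \<le> 2 * (a n - d\<^sup>2) + 2 * (a m - d\<^sup>2)" for n m
  proof -
    define w where "w = (1/2) *\<^sub>R (v n + v m)"
    have "w \<in> V"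
      using V(1) v by (simp add: w_def subspace_add subspace_scale)
    then have "d\<^sup>2 \<le> (dist x (w))\<^sup>2"
      using dle d0 by (simp add: power_mono)
    moreover have "(dist x (v n))\<^sup>2 \<le> a n" "(dist x (v m))\<^sup>2 \<le> a m"
      unfolding a_def using v(2) less_imp_le by (intro power_mono; blast intro: zero_le_dist)+
    moreover have "(dist (v n) (v m))\<^sup>2 = 2 * (dist x (v n))\<^sup>2 + 2 * (dist x (v m))\<^sup>2
        - 4 * (dist x (w))\<^sup>2"
      by (simp add: w_def dist_norm power2_norm_eq_inner inner_simps inner_commute field_simps)
    ultimately show ?thesis unfolding w_def[symmetric] by argo
  qed
  have "Cauchy v"
  proof (rule metric_CauchyI)
    fix e :: real assume "e > 0"
    then have "\<forall>\<^sub>F n in sequentially. a n < d\<^sup>2 + e\<^sup>2 / 4"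
      using order_tendstoD(2)[OF alim, of "d\<^sup>2 + e\<^sup>2 / 4"] by simp
    then obtain N where N: "\<And>n. n \<ge> N \<Longrightarrow> a n < d\<^sup>2 + e\<^sup>2 / 4"
      by (auto simp: eventually_sequentially)
    have "dist (v n) (v m) < e" if "n \<ge> N" "m \<ge> N" for n m
    proof -
      have "(dist (v n) (v m))\<^sup>2 < e\<^sup>2"
        using par[of n m] N[OF that(1)] N[OF that(2)] by (simp add: field_simps)
      then show ?thesis
        using \<open>e > 0\<close> by (simp add: power_less_imp_less_base)
    qed
    then show "\<exists>M. \<forall>m\<ge>M. \<forall>n\<ge>M. dist (v m) (v n) < e" by blast
  qed
  then obtain l where l: "v \<longlonglongrightarrow> l"
    using Cauchy_convergent_iff convergent_def by blast
  have lV: "l \<in> V"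
    using closed_sequentially[OF V(2)] v(1) l by blast
  have "dist x l \<le> d"
  proof (rule LIMSEQ_le)
    show "(\<lambda>n. dist x (v n)) \<longlonglongrightarrow> dist x l" by (intro tendsto_intros l)
    have "(\<lambda>n. d + 1 / Suc n) \<longlonglongrightarrow> d + 0"
      by (intro tendsto_intros LIMSEQ_Suc[OF lim_1_over_n])
    then show "(\<lambda>n. d + 1 / Suc n) \<longlonglongrightarrow> d" by simp
    show "\<exists>N. \<forall>n\<ge>N. dist x (v n) \<le> d + 1 / Suc n"
      using v(2) less_imp_le by blast
  qed
  then have best: "norm (x - l) \<le> norm (x - w)" if "w \<in> V" for w
    using dle[OF that] by (simp add: dist_norm)
  have "inner (x - l) w = 0" if w: "w \<in> V" for w
  proof (cases "w = 0")
    case False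
    define t where "t = inner (x - l) w / inner w w"
    have "l + t *\<^sub>R w \<in> V"
      using V(1) lV w by (simp add: subspace_add subspace_scale)
    from best[OF this] have "(norm (x - l))\<^sup>2 \<le> (norm (x - l - t *\<^sub>R w))\<^sup>2"
      by (simp add: power_mono diff_diff_eq)
    also have "\<dots> = (norm (x - l))\<^sup>2 - 2 * t * inner (x - l) w + t\<^sup>2 * inner w w"
      unfolding power2_norm_eq_inner
      by (simp add: inner_diff_left inner_diff_right inner_commute power2_eq_square algebra_simps)
    also have "\<dots> = (norm (x - l))\<^sup>2 - (inner (x - l) w)\<^sup>2 / inner w w"
      using False by (simp add: t_def power2_eq_square field_simps)
    finally have "(inner (x - l) w)\<^sup>2 / inner w w \<le> 0" by simp
    moreover have "inner w w > 0" using False by simp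
    ultimately show ?thesis by (simp add: divide_le_0_iff)
  qed simp
  then show ?thesis using that lV by blast
qed

lemma proper_closed_subspace_orth:
  fixes V :: "'a::{real_inner,complete_space} set"
  assumes "subspace V" "closed V" "V \<noteq> UNIV"
  obtains u where "norm u = 1" "\<And>w. w \<in> V \<Longrightarrow> inner u w = 0"
proof -
  obtain x where x: "x \<notin> V" using assms by blast
  obtain v where v: "v \<in> V" "\<And>w. w \<in> V \<Longrightarrow> inner (x - v) w = 0"
    using closed_subspace_decomp[OF assms(1,2)] by blast
  then have "x - v \<noteq> 0" using x by auto
  with v(2) show ?thesis
    by (intro that[of "(x - v) /\<^sub>R norm (x - v)"]) auto
qed

lemma orthonormal_imp_independent:
  assumes "orthonormal e"
  shows "inj e" "independent (range e)"
proof -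
  have o: "inner (e i) (e j) = of_bool (i = j)" for i j
    using assms by (auto simp: orthonormal_def)
  show "inj e"
  proof (rule injI)
    fix i j assume "e i = e j"
    then show "i = j" using o[of i i] o[of i j] by (auto split: if_splits)
  qed
  show "independent (range e)"
  proof
    assume "dependent (range e)"
    then obtain i where i: "e i \<in> span (range e - {e i})"
      unfolding dependent_def by blast
    have "span (range e - {e i}) \<subseteq> {x. inner x (e i) = 0}"
      using o by (intro span_minimal closed_orth) (auto split: if_splits)
    then have "inner (e i) (e i) = 0" using i by blast
    then show False using o[of i i] by simp
  qed
qed

text \<open>The linear map with the prescribed values is isometric on the span of the basis, and extends to
  the closure by uniform continuity.\<close>

lemma lin_isom_exists:
  fixes e :: "'i \<Rightarrow> 'a::real_inner" and f :: "'i \<Rightarrow> 'b::{real_inner,complete_space}"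
  assumes e: "orthonormal e" "complete_fam e" and f: "orthonormal f"
  obtains U where "lin_isom U" "\<And>i. U (e i) = f i"
proof -
  obtain g where g: "linear g" "\<And>x. x \<in> range e \<Longrightarrow> g x = f (inv_into UNIV e x)"
    using linear_independent_extend[OF orthonormal_imp_independent(2)[OF e(1)], of "\<lambda>x. f (inv_into UNIV e x)"]
    by blast
  have ge: "g (e i) = f i" for i
    using g(2) orthonormal_imp_independent(1)[OF e(1)] by simp
  let ?S = "span (range e)"
  have 1: "inner (g x) (g (e j)) = inner x (e j)" if "x \<in> ?S" for x j
  proof (rule linear_eq_on_span[where B = "range e" and f = "\<lambda>x. inner (g x) (g (e j))" and g = "\<lambda>x. inner x (e j)"])
    show "linear (\<lambda>x. inner (g x) (g (e j)))"
      by (rule linearI) (simp_all add: linear_add[OF g(1)] linear_scale[OF g(1)] inner_left_distrib)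
    show "linear (\<lambda>x. inner x (e j))"
      by (rule linearI) (simp_all add: inner_left_distrib)
    show "inner (g x) (g (e j)) = inner x (e j)" if "x \<in> range e" for x
      using that e(1) f by (auto simp: ge orthonormal_def)
  qed (use that in auto)
  have 2: "inner (g x) (g y) = inner x y" if "x \<in> ?S" "y \<in> ?S" for x y
  proof (rule linear_eq_on_span[where B = "range e" and f = "\<lambda>y. inner (g x) (g y)" and g = "\<lambda>y. inner x y"])
    show "linear (\<lambda>y. inner (g x) (g y))"
      by (rule linearI) (simp_all add: linear_add[OF g(1)] linear_scale[OF g(1)] inner_right_distrib)
    show "linear (\<lambda>y. inner x y)"
      by (rule linearI) (simp_all add: inner_right_distrib)
    show "inner (g x) (g y) = inner x y" if "y \<in> range e" for y
      using that 1[OF \<open>x \<in> ?S\<close>] by auto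
  qed (use that in auto)
  then have gn: "norm (g x) = norm x" if "x \<in> ?S" for x
    using that by (simp add: norm_eq_sqrt_inner)
  have gd: "dist (g x) (g y) = dist x y" if "x \<in> ?S" "y \<in> ?S" for x y
    using gn[of "x - y"] that by (simp add: dist_norm span_diff linear_diff[OF g(1)])
  then have "uniformly_continuous_on ?S g"
    unfolding uniformly_continuous_on_def by auto
  then obtain U where "uniformly_continuous_on (closure ?S) U" and UU: "\<And>x. x \<in> ?S \<Longrightarrow> g x = U x"
    using uniformly_continuous_on_extension_on_closure by metis
  then have "continuous_on UNIV U"
    using e(2) uniformly_continuous_imp_continuous by (auto simp: complete_fam_def)
  then have cU: "(\<lambda>n. U (s n)) \<longlonglongrightarrow> U l" if "s \<longlonglongrightarrow> l" for s l
    using that by (simp add: continuous_on_eq_continuous_at isCont_tendsto_compose)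
  have seq: "\<exists>s. (\<forall>n. s n \<in> ?S) \<and> s \<longlonglongrightarrow> x" for x
    using e(2) closure_sequential[of x ?S] by (auto simp: complete_fam_def)
  have "linear U"
  proof (rule linearI)
    fix x y
    obtain s t where s: "\<And>n. s n \<in> ?S" "s \<longlonglongrightarrow> x" and t: "\<And>n. t n \<in> ?S" "t \<longlonglongrightarrow> y"
      using seq by metis
    have "(\<lambda>n. U (s n + t n)) \<longlonglongrightarrow> U (x + y)"
      by (intro cU tendsto_intros s t)
    moreover have "U (s n + t n) = U (s n) + U (t n)" for n
      using UU s t g(1) by (metis linear_add span_add)
    moreover have "(\<lambda>n. U (s n) + U (t n)) \<longlonglongrightarrow> U x + U y"
      by (intro tendsto_intros cU s t)
    ultimately show "U (x + y) = U x + U y"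
      using LIMSEQ_unique by simp
  next
    fix c x
    obtain s where s: "\<And>n. s n \<in> ?S" "s \<longlonglongrightarrow> x"
      using seq by metis
    have "(\<lambda>n. U (c *\<^sub>R s n)) \<longlonglongrightarrow> U (c *\<^sub>R x)"
      by (intro cU tendsto_intros s)
    moreover have "U (c *\<^sub>R s n) = c *\<^sub>R U (s n)" for n
      using UU s g(1) by (metis linear_scale span_scale)
    moreover have "(\<lambda>n. c *\<^sub>R U (s n)) \<longlonglongrightarrow> c *\<^sub>R U x"
      by (intro tendsto_intros cU s)
    ultimately show "U (c *\<^sub>R x) = c *\<^sub>R U x"
      using LIMSEQ_unique by simp
  qed
  moreover have "norm (U x) = norm x" for x
  proof -
    obtain s where s: "\<And>n. s n \<in> ?S" "s \<longlonglongrightarrow> x"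
      using seq by metis
    have "(\<lambda>n. norm (U (s n))) \<longlonglongrightarrow> norm (U x)" "(\<lambda>n. norm (s n)) \<longlonglongrightarrow> norm x"
      by (intro tendsto_norm cU s)+
    moreover have "norm (U (s n)) = norm (s n)" for n
      using UU s gn by metis
    ultimately show ?thesis
      using LIMSEQ_unique by simp
  qed
  ultimately have "lin_isom U" by (simp add: lin_isom_def)
  moreover have "U (e i) = f i" for i
    using UU[of "e i"] ge by (simp add: span_base)
  ultimately show ?thesis using that by blast
qed

text \<open>The inverse of a bijective operator.\<close>

abbreviation opinv :: "('a \<Rightarrow> 'a) \<Rightarrow> 'a \<Rightarrow> 'a"
  where "opinv U \<equiv> inv_into UNIV U"

lemma orth_group_compose: "U \<in> orth_group \<Longrightarrow> V \<in> orth_group \<Longrightarrow> U \<circ> V \<in> orth_group"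
  by (simp add: orth_group_def lin_isom_compose comp_surj del: o_apply)

lemma orth_group_id: "id \<in> orth_group"
  by (simp add: orth_group_def lin_isom_id)

lemma orth_group_bij: "U \<in> orth_group \<Longrightarrow> bij U"
  by (simp add: orth_group_def bij_def lin_isom_inj)

lemma orth_group_inv:
  assumes "U \<in> orth_group" shows "opinv U \<in> orth_group"
proof -
  have b: "bij U" using assms by (rule orth_group_bij)
  then have i: "U (opinv U x) = x" "opinv U (U x) = x" for x
    by (simp_all add: bij_is_surj surj_f_inv_f bij_is_inj)
  have U: "linear U" "\<And>x. norm (U x) = norm x"
    using assms by (auto simp: orth_group_def lin_isom_def)
  have "linear (opinv U)"
  proof (rule linearI)
    fix x y and c :: real
    have "opinv U x + opinv U y = opinv U (U (opinv U x + opinv U y))"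
      by (simp only: i)
    then show "opinv U (x + y) = opinv U x + opinv U y"
      by (simp add: linear_add[OF U(1)] i)
    have "c *\<^sub>R opinv U x = opinv U (U (c *\<^sub>R opinv U x))"
      by (simp only: i)
    then show "opinv U (c *\<^sub>R x) = c *\<^sub>R opinv U x"
      by (simp add: linear_scale[OF U(1)] i)
  qed
  moreover have "norm (opinv U x) = norm x" for x
    using U(2)[of "opinv U x"] by (simp add: i)
  ultimately show ?thesis
    using b by (auto simp: orth_group_def lin_isom_def bij_imp_bij_inv bij_is_surj)
qed

lemma orth_group_inv_apply:
  assumes "U \<in> orth_group" shows "U (opinv U x) = x" "opinv U (U x) = x"
  using orth_group_bij[OF assms] by (simp_all add: bij_is_surj surj_f_inv_f bij_is_inj)

lemma orth_group_lin_isom: "U \<in> orth_group \<Longrightarrow> lin_isom U"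
  by (simp add: orth_group_def)

lemma orth_group_exists:
  fixes e f :: "'i \<Rightarrow> 'a::{real_inner,complete_space}"
  assumes e: "orthonormal e" "complete_fam e" and f: "orthonormal f" "complete_fam f"
  obtains U where "U \<in> orth_group" "\<And>i. U (e i) = f i"
proof -
  obtain U where U: "lin_isom U" "\<And>i. U (e i) = f i"
    using lin_isom_exists[OF e f(1)] by blast
  obtain V where V: "lin_isom V" "\<And>i. V (f i) = e i"
    using lin_isom_exists[OF f e(1)] by blast
  have "U \<circ> V = id"
    using lin_isom_eqI[OF f(2) lin_isom_compose[OF U(1) V(1)] lin_isom_id] by (simp add: U V)
  then have "surj U" by (metis comp_apply id_apply surjI)
  then show ?thesis using that U by (simp add: orth_group_def)
qed

lemma subspace_closure_of:
  fixes S :: "'a::real_normed_vector set"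
  assumes S: "subspace S" shows "subspace (closure S)"
proof (rule subspaceI)
  show "0 \<in> closure S"
    using S closure_subset subspace_0 by blast
next
  fix x y assume "x \<in> closure S" "y \<in> closure S"
  then obtain s t where s: "\<And>n. s n \<in> S" "s \<longlonglongrightarrow> x" and t: "\<And>n. t n \<in> S" "t \<longlonglongrightarrow> y"
    unfolding closure_sequential by metis
  then have "\<forall>n. s n + t n \<in> S" "(\<lambda>n. s n + t n) \<longlonglongrightarrow> x + y"
    using S by (auto intro: tendsto_add subspace_add)
  then show "x + y \<in> closure S"
    unfolding closure_sequential by (intro exI[of _ "\<lambda>n. s n + t n"]) simp
next
  fix c x assume "x \<in> closure S"
  then obtain s where s: "\<And>n. s n \<in> S" "s \<longlonglongrightarrow> x"
    unfolding closure_sequential by metis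
  then have "\<forall>n. c *\<^sub>R s n \<in> S" "(\<lambda>n. c *\<^sub>R s n) \<longlonglongrightarrow> c *\<^sub>R x"
    using S by (auto intro: tendsto_scaleR subspace_scale)
  then show "c *\<^sub>R x \<in> closure S"
    unfolding closure_sequential by (intro exI[of _ "\<lambda>n. c *\<^sub>R s n"]) simp
qed

section \<open>Hilbert bases\<close>

text \<open>The same notion for sets, as needed for the maximality argument below.\<close>

definition orthonormal_set :: "'a::real_inner set \<Rightarrow> bool"
  where "orthonormal_set S \<longleftrightarrow> (\<forall>x\<in>S. \<forall>y\<in>S. inner x y = of_bool (x = y))"

lemma orthonormal_set_extends:
  fixes S :: "'a::{real_inner,complete_space} set"
  assumes S: "orthonormal_set S"
  obtains T where "S \<subseteq> T" "orthonormal_set T" "closure (span T) = UNIV"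
proof -
  let ?A = "{T. orthonormal_set T \<and> S \<subseteq> T}"
  have "\<exists>M\<in>?A. \<forall>X\<in>?A. M \<subseteq> X \<longrightarrow> X = M"
  proof (rule subset_Zorn_nonempty)
    show "?A \<noteq> {}" using S by blast
    fix C assume C: "C \<noteq> {}" "subset.chain ?A C"
    then have CA: "C \<subseteq> ?A" and ch: "\<And>X Y. X \<in> C \<Longrightarrow> Y \<in> C \<Longrightarrow> X \<subseteq> Y \<or> Y \<subseteq> X"
      by (auto simp: subset_chain_def)
    have "inner x y = of_bool (x = y)" if xy: "x \<in> \<Union>C" "y \<in> \<Union>C" for x y
    proof -
      obtain X Y where "X \<in> C" "x \<in> X" "Y \<in> C" "y \<in> Y" using xy by blast
      then obtain Z where "Z \<in> C" "x \<in> Z" "y \<in> Z" using ch[of X Y] by blast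
      then show ?thesis using CA unfolding orthonormal_set_def by blast
    qed
    then have "orthonormal_set (\<Union>C)"
      unfolding orthonormal_set_def by blast
    moreover have "S \<subseteq> \<Union>C"
      using C(1) CA by blast
    ultimately show "\<Union>C \<in> ?A" by simp
  qed
  then obtain T where TA: "T \<in> ?A" and maxA: "\<forall>X\<in>?A. T \<subseteq> X \<longrightarrow> X = T"
    by (rule bexE)
  then have T: "orthonormal_set T" "S \<subseteq> T" by simp_all
  have max: "X = T" if "orthonormal_set X" "T \<subseteq> X" for X
    using maxA T(2) that by (metis (mono_tags, lifting) mem_Collect_eq subset_trans)
  have "closure (span T) = UNIV"
  proof (rule ccontr)
    assume "closure (span T) \<noteq> UNIV"
    then obtain u where u: "norm u = 1" "\<And>w. w \<in> closure (span T) \<Longrightarrow> inner u w = 0"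
      using proper_closed_subspace_orth[OF subspace_closure_of[OF subspace_span[of T]] closed_closure] by blast
    have uT: "inner u t = 0" if "t \<in> T" for t
      using u(2)[of t] that closure_subset[of "span T"] span_base[of t T] by blast
    have uu: "inner u u = 1" using u(1) by (simp add: norm_eq_1)
    have "orthonormal_set (insert u T)"
      unfolding orthonormal_set_def
    proof (intro ballI)
      fix x y assume xy: "x \<in> insert u T" "y \<in> insert u T"
      have uT': "inner t u = 0" if "t \<in> T" for t
        using uT[OF that] by (simp add: inner_commute)
      have "u \<notin> T" using uT uu by force
      then show "inner x y = of_bool (x = y)"
        using xy T(1) uT uT' uu unfolding orthonormal_set_def by (cases "x = u"; cases "y = u") auto
    qed
    then have "u \<in> T" using max[of "insert u T"] by blast
    then show False using uT uu by force
  qed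
  then show ?thesis using that T by blast
qed

lemma countable_separated:
  fixes f :: "'b \<Rightarrow> 'a::metric_space" and D :: "'a set"
  assumes D: "countable D" "closure D = UNIV" and r: "r > 0"
    and S: "\<And>x y. x \<in> S \<Longrightarrow> y \<in> S \<Longrightarrow> x \<noteq> y \<Longrightarrow> dist (f x) (f y) \<ge> r"
  shows "countable S"
proof -
  have "\<exists>d\<in>D. dist d (f x) < r / 2" for x
    using closure_approachable[of "f x" D] D(2) r half_gt_zero[OF r] by blast
  then obtain d where d: "\<And>x. d x \<in> D" "\<And>x. dist (d x) (f x) < r / 2" by metis
  have "inj_on d S"
  proof (rule inj_onI, rule ccontr)
    fix x y assume xy: "x \<in> S" "y \<in> S" "d x = d y" "x \<noteq> y"
    have "dist (f x) (f y) < r"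
      using d(2)[of x] d(2)[of y] xy(3) dist_triangle3[of "f x" "f y" "d x"] by simp
    with S[OF xy(1,2,4)] show False by simp
  qed
  moreover have "countable (d ` S)"
    using D(1) d(1) by (meson countable_subset image_subsetI)
  ultimately show ?thesis using countable_image_inj_on by blast
qed

lemma orthonormal_range: "orthonormal e \<Longrightarrow> orthonormal_set (range e)"
  unfolding orthonormal_set_def
  by (auto simp: orthonormal_def inj_eq[OF orthonormal_imp_independent(1)])

lemma finite_orthonormal_set_spans:
  fixes T :: "'a::real_inner set"
  assumes T: "orthonormal_set T" "closure (span T) = UNIV" "finite T"
  shows "span T = UNIV"
proof -
  have "x \<in> span T" for x
  proof -
    define y where "y = (\<Sum>t\<in>T. inner x t *\<^sub>R t)"
    have y: "y \<in> span T"
      unfolding y_def by (intro span_sum span_scale span_base)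
    have "inner s (x - y) = 0" if s: "s \<in> T" for s
    proof -
      have "inner s y = (\<Sum>t\<in>T. if t = s then inner x t else 0)"
        unfolding y_def inner_sum_right
        using T(1) s by (intro sum.cong) (auto simp: orthonormal_set_def)
      also have "\<dots> = inner x s"
        using T(3) s by simp
      finally show ?thesis by (simp add: inner_diff_right inner_commute)
    qed
    then have "span T \<subseteq> {z. inner z (x - y) = 0}"
      by (intro span_minimal closed_orth) auto
    then have "closure (span T) \<subseteq> {z. inner z (x - y) = 0}"
      by (rule closure_minimal) (rule closed_orth)
    then have "x - y \<in> {z. inner z (x - y) = 0}" using T(2) by blast
    then show ?thesis using y by simp
  qed
  then show ?thesis by blast
qed

text \<open>An infinite-dimensional separable real Hilbert space; \<open>D\<close> is a countable dense subset.\<close>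

locale separable_hilbert =
  fixes D :: "'a::{real_inner,complete_space} set"
  assumes D: "countable D" "closure D = UNIV"
    and infinite_dim: "\<not> (\<exists>S::'a set. finite S \<and> span S = UNIV)"
begin

lemma orthonormal_set_countable:
  fixes T :: "'a set"
  assumes "orthonormal_set T" shows "countable T"
proof (rule countable_separated[OF D, where r = 1 and f = "\<lambda>x. x"])
  fix x y assume "x \<in> T" "y \<in> T" "x \<noteq> y"
  then have "inner x x = 1" "inner y y = 1" "inner x y = 0" "inner y x = 0"
    using assms by (auto simp: orthonormal_set_def)
  then have "(dist x y)\<^sup>2 = 2"
    by (simp add: dist_norm power2_norm_eq_inner inner_diff_left inner_diff_right)
  then have "1\<^sup>2 \<le> (dist x y)\<^sup>2" by simp
  then show "1 \<le> dist x y" by (rule power2_le_imp_le) simp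
qed simp

lemma basis_exists:
  assumes "countable (UNIV :: 'i set)" "infinite (UNIV :: 'i set)"
  obtains e :: "'i \<Rightarrow> 'a" where "orthonormal e" "complete_fam e"
proof -
  obtain T :: "'a set" where T: "orthonormal_set T" "closure (span T) = UNIV"
    using orthonormal_set_extends[of "{}"] by (auto simp: orthonormal_set_def)
  have "infinite T"
    using finite_orthonormal_set_spans[OF T] infinite_dim by blast
  then have "bij_betw (from_nat_into T) UNIV T"
    using orthonormal_set_countable[OF T(1)] by (rule bij_betw_from_nat_into[rotated])
  moreover have "bij_betw (to_nat_on (UNIV::'i set)) UNIV UNIV"
    using assms by (rule to_nat_on_infinite)
  ultimately have b: "bij_betw (from_nat_into T \<circ> to_nat_on (UNIV::'i set)) UNIV T"
    by (rule bij_betw_trans[rotated])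
  let ?e = "from_nat_into T \<circ> to_nat_on (UNIV::'i set)"
  have r: "range ?e = T" "inj ?e" using b by (auto simp: bij_betw_def)
  have "orthonormal ?e"
    unfolding orthonormal_def
  proof (intro allI)
    fix i j
    have "?e i \<in> T" "?e j \<in> T" using r by blast+
    then show "inner (?e i) (?e j) = of_bool (i = j)"
      using T(1) r(2) unfolding orthonormal_set_def by (simp only: inj_eq)
  qed
  then show ?thesis using that[of ?e] r T(2) by (simp add: complete_fam_def)
qed

lemma orthonormal_completion:
  fixes x :: "'i \<Rightarrow> 'a" and z :: "nat \<Rightarrow> 'a"
  assumes x: "orthonormal x" and z: "orthonormal z" and xz: "\<And>i n. inner (x i) (z n) = 0"
  obtains r :: "nat \<Rightarrow> 'a" where "orthonormal (case_sum x r)" "complete_fam (case_sum x r)"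
proof -
  have "orthonormal_set (range x \<union> range z)"
  proof -
    have "x i \<noteq> z n" for i n
      using xz[of i n] x unfolding orthonormal_def by (metis of_bool_eq(2) zero_neq_one)
    then show ?thesis
      using orthonormal_range[OF x] orthonormal_range[OF z] xz
      unfolding orthonormal_set_def by (auto simp: inner_commute dest: sym)
  qed
  then obtain T where T: "range x \<union> range z \<subseteq> T" "orthonormal_set T" "closure (span T) = UNIV"
    using orthonormal_set_extends by blast
  define R where "R = T - range x"
  have "range z \<subseteq> R"
  proof -
    have "z n \<noteq> x i" for i n
      using xz[of i n] x unfolding orthonormal_def by (metis of_bool_eq(2) zero_neq_one)
    then show ?thesis using T(1) by (auto simp: R_def)
  qed
  moreover have "infinite (range z)"
    using orthonormal_imp_independent(1)[OF z] by (simp add: finite_image_iff)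
  ultimately have "infinite R" using finite_subset by blast
  moreover have "countable R"
    using orthonormal_set_countable[OF T(2)] by (simp add: R_def)
  ultimately have b: "bij_betw (from_nat_into R) UNIV R"
    by (simp add: bij_betw_from_nat_into)
  let ?r = "from_nat_into R" let ?e = "case_sum x ?r"
  have inj: "inj ?e"
  proof (rule injI)
    fix i j assume "?e i = ?e j"
    moreover have "?r n \<noteq> x k" "x k \<noteq> ?r n" for n k
      using b by (auto simp: bij_betw_def R_def)
    ultimately show "i = j"
      using orthonormal_imp_independent(1)[OF x] b
      by (auto simp: bij_betw_def inj_eq split: sum.splits)
  qed
  have ran: "range ?e = T"
  proof -
    have "range ?e = range x \<union> range ?r"
      by (force simp: image_iff split: sum.splits)
    also have "\<dots> = T" using b T(1) by (auto simp: bij_betw_def R_def)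
    finally show ?thesis .
  qed
  have "orthonormal ?e"
    unfolding orthonormal_def
  proof (intro allI)
    fix i j
    have "?e i \<in> T" "?e j \<in> T" using ran by blast+
    then show "inner (?e i) (?e j) = of_bool (i = j)"
      using T(2) inj unfolding orthonormal_set_def by (simp only: inj_eq)
  qed
  then show ?thesis using that ran T(3) by (simp add: complete_fam_def)
qed

text \<open>Orthogonal operators act transitively on orthonormal families of a given index set whose orthogonal
  complement is infinite-dimensional; this is expressed by the orthonormal sequences \<open>z\<close> and \<open>w\<close>.\<close>

lemma orth_group_extends:
  fixes x y :: "'i \<Rightarrow> 'a" and z w :: "nat \<Rightarrow> 'a"
  assumes x: "orthonormal x" "orthonormal z" "\<And>i n. inner (x i) (z n) = 0"
    and y: "orthonormal y" "orthonormal w" "\<And>i n. inner (y i) (w n) = 0"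
  obtains U where "U \<in> orth_group" "\<And>i. U (x i) = y i"
proof -
  obtain r :: "nat \<Rightarrow> 'a" where r: "orthonormal (case_sum x r)" "complete_fam (case_sum x r)"
    using orthonormal_completion[OF x] by blast
  obtain s :: "nat \<Rightarrow> 'a" where s: "orthonormal (case_sum y s)" "complete_fam (case_sum y s)"
    using orthonormal_completion[OF y] by blast
  obtain U where "U \<in> orth_group" "\<And>i. U (case_sum x r i) = case_sum y s i"
    using orth_group_exists[OF r s] by blast
  then show ?thesis using that by (metis old.sum.simps(5))
qed

end

section \<open>Block-monomial operators\<close>

lemma preimage_closed_subspace:
  fixes U :: "'a::real_inner \<Rightarrow> 'b::real_inner" and V :: "'b set"
  assumes "lin_isom U" "subspace V" "closed V"
  shows "closed {x. U x \<in> V}" "subspace {x. U x \<in> V}"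
proof -
  show "closed {x. U x \<in> V}"
    using continuous_closed_vimage[OF assms(3), of U] lin_isom_continuous[OF assms(1), of UNIV]
    by (simp add: vimage_def continuous_on_eq_continuous_at)
  show "subspace {x. U x \<in> V}"
    using assms(2) lin_isom_linear[OF assms(1)]
    by (auto simp: subspace_def linear_0 linear_add linear_scale)
qed

text \<open>The space is the Hilbert sum of the ranges of the isometric embeddings \<open>\<iota> i\<close> of the space into
  itself. The auxiliary Hilbert basis \<open>b\<close> is used only to express that the ranges are orthogonal to
  each other and that they span a dense subspace.\<close>

locale hilbert_copies =
  fixes \<iota> :: "'i \<Rightarrow> 'a::{real_inner,complete_space} \<Rightarrow> 'a" and b :: "nat \<Rightarrow> 'a"
  assumes b: "orthonormal b" "complete_fam b"
    and isom: "lin_isom (\<iota> i)"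
    and copies: "orthonormal (\<lambda>(i,k). \<iota> i (b k))" "complete_fam (\<lambda>(i,k). \<iota> i (b k))"
begin

lemma copies_orth:
  assumes "i \<noteq> j" shows "inner (\<iota> i x) (\<iota> j y) = 0"
proof -
  have *: "inner (\<iota> i (b k)) (\<iota> j (b n)) = 0" for k n
    using copies(1)[unfolded orthonormal_def, rule_format, of "(i,k)" "(j,n)"] assms by simp
  have "x \<in> {x. \<iota> i x \<in> {z. inner z (\<iota> j (b n)) = 0}}" for x n
    using complete_fam_induct[OF b(2) preimage_closed_subspace(2,1)[OF isom closed_orth(2,1)]] * by simp
  then have **: "inner (\<iota> j (b n)) (\<iota> i x) = 0" for n
    by (simp add: inner_commute)
  have "y \<in> {y. \<iota> j y \<in> {z. inner z (\<iota> i x) = 0}}"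
    using complete_fam_induct[OF b(2) preimage_closed_subspace(2,1)[OF isom closed_orth(2,1)]] ** by simp
  then show ?thesis by (simp add: inner_commute)
qed

lemma copies_eqI:
  assumes "lin_isom U" "lin_isom V" "\<And>i x. U (\<iota> i x) = V (\<iota> i x)"
  shows "U = V"
  using lin_isom_eqI[OF copies(2) assms(1,2)] assms(3) by auto

lemma monomial_exists:
  assumes \<pi>: "bij \<pi>" and g: "\<And>i. g i \<in> orth_group"
  shows "\<exists>U\<in>orth_group. \<forall>i x. U (\<iota> i x) = \<iota> (\<pi> i) (g i x)"
proof -
  let ?f = "\<lambda>(i,k). \<iota> (\<pi> i) (g i (b k))"
  have gi: "lin_isom (g i)" for i using g orth_group_lin_isom by blast
  have f: "orthonormal ?f"
    unfolding orthonormal_def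
  proof (intro allI)
    fix p q :: "'i \<times> nat"
    obtain i k where p: "p = (i,k)" by (cases p)
    obtain j n where q: "q = (j,n)" by (cases q)
    show "inner (?f p) (?f q) = of_bool (p = q)"
    proof (cases "i = j")
      case True
      then show ?thesis
        using b(1) by (simp add: p q lin_isom_inner[OF isom] lin_isom_inner[OF gi] orthonormal_def)
    next
      case False
      then have "\<pi> i \<noteq> \<pi> j" using \<pi> by (metis bij_pointE)
      then show ?thesis using False by (simp add: p q copies_orth)
    qed
  qed
  have cf: "complete_fam ?f"
  proof -
    let ?V = "closure (span (range ?f))"
    have V: "subspace ?V" "closed ?V"
      by (simp_all add: subspace_closure_of)
    have 1: "\<iota> (\<pi> i) (g i (b k)) \<in> ?V" for i k
    proof -
      have "?f (i,k) \<in> span (range ?f)" by (intro span_base rangeI)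
      then show ?thesis using closure_subset by auto
    qed
    have 2: "x \<in> {x. (\<iota> (\<pi> i) \<circ> g i) x \<in> ?V}" for i x
      by (rule complete_fam_induct[OF b(2) preimage_closed_subspace(2,1)[OF lin_isom_compose[OF isom gi] V]])
        (simp add: 1)
    have 3: "\<iota> j (b k) \<in> ?V" for j k
    proof -
      obtain i where i: "j = \<pi> i" using \<pi> by (metis bij_pointE)
      obtain y where "b k = g i y" using g[of i] by (auto simp: orth_group_def surj_def)
      then show ?thesis using 2[of y i] i by simp
    qed
    have "x \<in> ?V" for x
      by (rule complete_fam_induct[OF copies(2) V]) (simp add: 3 split: prod.split)
    then show ?thesis by (auto simp: complete_fam_def)
  qed
  obtain U where U: "U \<in> orth_group" "\<And>p. U ((\<lambda>(i,k). \<iota> i (b k)) p) = ?f p"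
    using orth_group_exists[OF copies f cf] by blast
  have UL: "lin_isom U" using U(1) by (rule orth_group_lin_isom)
  have "U (\<iota> i x) = \<iota> (\<pi> i) (g i x)" for i x
  proof -
    have "U \<circ> \<iota> i = \<iota> (\<pi> i) \<circ> g i"
      by (rule lin_isom_eqI[OF b(2)]) (use U(2)[of "(i,_)"] in \<open>auto intro!: lin_isom_compose UL isom gi\<close>)
    then show ?thesis by (metis comp_apply)
  qed
  then show ?thesis using U(1) by blast
qed

text \<open>The operator that sends the copy of index \<open>i\<close> to the copy of index \<open>\<pi> i\<close> and acts by \<open>g i\<close> between
  them. It is orthogonal if \<open>\<pi>\<close> is a bijection and all \<open>g i\<close> are orthogonal.\<close>

definition monomial :: "('i \<Rightarrow> 'i) \<Rightarrow> ('i \<Rightarrow> 'a \<Rightarrow> 'a) \<Rightarrow> 'a \<Rightarrow> 'a"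
  where "monomial \<pi> g = (SOME U. U \<in> orth_group \<and> (\<forall>i x. U (\<iota> i x) = \<iota> (\<pi> i) (g i x)))"

lemma monomial:
  assumes "bij \<pi>" "\<And>i. g i \<in> orth_group"
  shows "monomial \<pi> g \<in> orth_group" "monomial \<pi> g (\<iota> i x) = \<iota> (\<pi> i) (g i x)"
proof -
  have "\<exists>U. U \<in> orth_group \<and> (\<forall>i x. U (\<iota> i x) = \<iota> (\<pi> i) (g i x))"
    using monomial_exists[of \<pi> g] assms by blast
  from someI_ex[OF this] show "monomial \<pi> g \<in> orth_group" "monomial \<pi> g (\<iota> i x) = \<iota> (\<pi> i) (g i x)"
    unfolding monomial_def by blast+
qed

lemma in_copy:
  assumes "\<And>j k. j \<noteq> i \<Longrightarrow> inner (\<iota> j (b k)) y = 0"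
  shows "y \<in> range (\<iota> i)"
proof -
  have "complete (range (\<iota> i))"
  proof -
    have "complete (UNIV :: 'a set)" by (simp add: complete_UNIV)
    then show ?thesis
      using complete_isometric_image[of 1 UNIV "\<iota> i"] lin_isom_bounded_linear[OF isom] lin_isom_norm[OF isom]
      by simp
  qed
  then have "closed (range (\<iota> i))" by (rule complete_imp_closed)
  moreover have "subspace (range (\<iota> i))"
    using linear_subspace_image[OF lin_isom_linear[OF isom] subspace_UNIV] .
  ultimately obtain v where v: "v \<in> range (\<iota> i)" "\<And>w. w \<in> range (\<iota> i) \<Longrightarrow> inner (y - v) w = 0"
    using closed_subspace_decomp by metis
  have "inner ((\<lambda>(i,k). \<iota> i (b k)) p) (y - v) = 0" for p
  proof -
    obtain j k where p: "p = (j,k)" by (cases p)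
    show ?thesis
    proof (cases "j = i")
      case True
      then show ?thesis using v(2)[of "\<iota> i (b k)"] by (simp add: p inner_commute)
    next
      case False
      then show ?thesis using v(1) assms by (auto simp: p inner_diff_right copies_orth)
    qed
  qed
  then have "y - v = 0" using complete_fam_orth[OF copies(2)] by blast
  then show ?thesis using v(1) by simp
qed

lemma fix_other_copies:
  assumes U: "U \<in> orth_group" and fx: "\<And>j x. j \<noteq> i \<Longrightarrow> U (\<iota> j x) = \<iota> j x"
  obtains g where "g \<in> orth_group" "\<And>x. U (\<iota> i x) = \<iota> i (g x)"
proof -
  have *: "V (\<iota> i x) \<in> range (\<iota> i)" if V: "V \<in> orth_group" "\<And>j x. j \<noteq> i \<Longrightarrow> V (\<iota> j x) = \<iota> j x" for V x
  proof (rule in_copy)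
    fix j k assume j: "j \<noteq> i"
    have "inner (\<iota> j (b k)) (V (\<iota> i x)) = inner (V (\<iota> j (b k))) (V (\<iota> i x))"
      using V(2)[OF j] by simp
    also have "\<dots> = 0"
      using copies_orth[OF j] lin_isom_inner[OF orth_group_lin_isom[OF V(1)]] by simp
    finally show "inner (\<iota> j (b k)) (V (\<iota> i x)) = 0" .
  qed
  define g where "g x = inv_into UNIV (\<iota> i) (U (\<iota> i x))" for x
  have g: "\<iota> i (g x) = U (\<iota> i x)" for x
    unfolding g_def using *[OF U fx] by (simp add: f_inv_into_f)
  have inj: "x = y" if "\<iota> i x = \<iota> i y" for x y
    using lin_isom_inj[OF isom] that by (meson injD)
  note lin = lin_isom_linear[OF isom[of i]] lin_isom_linear[OF orth_group_lin_isom[OF U]]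
  have "linear g"
  proof (rule linearI)
    show "g (x + y) = g x + g y" for x y
      by (rule inj) (simp add: g linear_add[OF lin(1)] linear_add[OF lin(2)])
    show "g (c *\<^sub>R x) = c *\<^sub>R g x" for c x
      by (rule inj) (simp add: g linear_scale[OF lin(1)] linear_scale[OF lin(2)])
  qed
  moreover have "norm (g x) = norm x" for x
    using lin_isom_norm[OF isom, of i "g x"] lin_isom_norm[OF isom, of i x]
      lin_isom_norm[OF orth_group_lin_isom[OF U], of "\<iota> i x"] by (simp add: g)
  moreover have "surj g"
  proof -
    have fx': "opinv U (\<iota> j x) = \<iota> j x" if "j \<noteq> i" for j x
      using fx[OF that] orth_group_inv_apply(2)[OF U] by metis
    have "\<exists>x. y = g x" for y
    proof -
      obtain x where "opinv U (\<iota> i y) = \<iota> i x"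
        using *[OF orth_group_inv[OF U] fx'] by blast
      then have "\<iota> i y = \<iota> i (g x)"
        using orth_group_inv_apply(1)[OF U] g by metis
      then show ?thesis using inj by blast
    qed
    then show ?thesis by (auto simp: surj_def)
  qed
  ultimately show ?thesis using that[of g] g by (simp add: orth_group_def lin_isom_def)
qed

end

section \<open>Length functions on the orthogonal group are bounded\<close>

text \<open>A length function (pseudo-norm) on the group of orthogonal operators. Of \<open>l id = 0\<close> nothing is
  needed.\<close>

locale length_function =
  fixes l :: "('a::{real_inner,complete_space} \<Rightarrow> 'a) \<Rightarrow> real"
  assumes l_nonneg: "U \<in> orth_group \<Longrightarrow> 0 \<le> l U"
    and l_comp: "U \<in> orth_group \<Longrightarrow> V \<in> orth_group \<Longrightarrow> l (U \<circ> V) \<le> l U + l V"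
    and l_inv: "U \<in> orth_group \<Longrightarrow> l (opinv U) \<le> l U"

text \<open>The orthogonal operators that fix every vector of \<open>X\<close>.\<close>

definition pointwise_stabilizer :: "'a::real_inner set \<Rightarrow> ('a \<Rightarrow> 'a) set"
  where "pointwise_stabilizer X = {U \<in> orth_group. \<forall>x\<in>X. U x = x}"

text \<open>A length function, and copies of the space indexed by \<open>\<int>\<^sup>2\<close>.\<close>

locale copies_length = hilbert_copies \<iota> b + length_function l
  for \<iota> :: "int \<times> int \<Rightarrow> 'a::{real_inner,complete_space} \<Rightarrow> 'a"
    and b :: "nat \<Rightarrow> 'a" and l :: "('a \<Rightarrow> 'a) \<Rightarrow> real"
begin

abbreviation other_copies :: "'a set"
  where "other_copies \<equiv> (\<Union>i\<in>- {(0,0)}. range (\<iota> i))"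

text \<open>Let \<open>u\<close> act by \<open>g\<^sub>m\<close> on the copies with index \<open>(m, j)\<close>, \<open>m \<ge> 0\<close>, \<open>j \<ge> 0\<close>, and trivially elsewhere.
  Let \<open>s\<close> be the shift of the first coordinate and \<open>T\<close> the shift of the second coordinate on the row
  \<open>m = 0\<close>, trivial on the other rows. In the commutator of \<open>V = s\<^sup>-\<^sup>n u s\<^sup>n\<close> with \<open>T\<close>, all rows but \<open>m = 0\<close>
  cancel. In that row \<open>V\<close> acts by \<open>g\<^sub>n\<close> on the half-line \<open>j \<ge> 0\<close>, and conjugation by \<open>T\<close> shifts the half-line
  by one, so that only the factor \<open>g\<^sub>n\<close> at \<open>(0, 0)\<close> remains. The constants \<open>c\<close> and \<open>d\<close> depend on the
  whole sequence but not on \<open>n\<close>.\<close>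

lemma commutator_trick:
  assumes g: "\<And>n::nat. g n \<in> orth_group"
  obtains c d where "0 \<le> c" "0 \<le> d"
    "\<forall>n. \<forall>U\<in>pointwise_stabilizer other_copies.
      (\<forall>x. U (\<iota> (0,0) x) = \<iota> (0,0) (g n x)) \<longrightarrow> l U \<le> real n * c + d"
proof -
  define G where "G n p = (if 0 \<le> fst p + int n \<and> 0 \<le> snd p then g (nat (fst p + int n)) else id)"
    for n :: nat and p :: "int \<times> int"
  have G: "G n p \<in> orth_group" for n p
    by (simp add: G_def g orth_group_id)
  define s s' where "s = monomial (\<lambda>(m,j). (m + 1, j)) (\<lambda>_. id)"
    and "s' = monomial (\<lambda>(m,j). (m - 1, j)) (\<lambda>_. id)"
  have bij: "bij (\<lambda>(m,j). (m + k, j))" for k :: int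
    by (rule bij_betw_byWitness[where f' = "\<lambda>(m,j). (m - k, j)"]) auto
  have bijT: "bij (\<lambda>(m,j). (m, if m = 0 then j + k else j))" for k :: int
    by (rule bij_betw_byWitness[where f' = "\<lambda>(m,j). (m, if m = 0 then j - k else j)"]) (auto split: if_splits)
  have bij': "bij (\<lambda>(m,j). (m - k, j))" for k :: int
    by (rule bij_betw_byWitness[where f' = "\<lambda>(m,j). (m + k, j)"]) auto
  have bijT': "bij (\<lambda>(m,j). (m, if m = 0 then j - k else j))" for k :: int
    by (rule bij_betw_byWitness[where f' = "\<lambda>(m,j). (m, if m = 0 then j + k else j)"]) (auto split: if_splits)
  define T T' where "T = monomial (\<lambda>(m,j). (m, if m = 0 then j + 1 else j)) (\<lambda>_. id)"
    and "T' = monomial (\<lambda>(m,j). (m, if m = 0 then j - 1 else j)) (\<lambda>_. id)"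
  define u where "u = monomial id (G 0)"
  have s: "s \<in> orth_group" "s (\<iota> (m,j) x) = \<iota> (m + 1, j) x" for m j x
    unfolding s_def using monomial[OF bij[of 1], of "\<lambda>_. id"] by (simp_all add: orth_group_id)
  have s': "s' \<in> orth_group" "s' (\<iota> (m,j) x) = \<iota> (m - 1, j) x" for m j x
    unfolding s'_def using monomial[OF bij'[of 1], of "\<lambda>_. id"] by (simp_all add: orth_group_id)
  have T: "T \<in> orth_group" "T (\<iota> (m,j) x) = \<iota> (m, if m = 0 then j + 1 else j) x" for m j x
    unfolding T_def using monomial[OF bijT[of 1], of "\<lambda>_. id"] by (simp_all add: orth_group_id)
  have T': "T' \<in> orth_group" "T' (\<iota> (m,j) x) = \<iota> (m, if m = 0 then j - 1 else j) x" for m j x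
    unfolding T'_def using monomial[OF bijT'[of 1], of "\<lambda>_. id"] by (simp_all add: orth_group_id)
  have u: "u \<in> orth_group" "u (\<iota> p x) = \<iota> p (G 0 p x)" for p x
    unfolding u_def using monomial[of id "G 0"] G by simp_all
  \<comment> \<open>\<open>V\<close> is the conjugate of \<open>u\<close> by the \<open>n\<close>-th power of the shift \<open>s\<close>.\<close>
  have conj: "\<exists>V\<in>orth_group. (\<forall>p x. V (\<iota> p x) = \<iota> p (G n p x)) \<and> l V \<le> real n * (l s + l s') + l u" for n
  proof (induction n)
    case 0
    then show ?case using u by auto
  next
    case (Suc n)
    then obtain V where V: "V \<in> orth_group" "\<And>p x. V (\<iota> p x) = \<iota> p (G n p x)"
      "l V \<le> real n * (l s + l s') + l u" by blast
    let ?W = "s' \<circ> (V \<circ> s)"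
    have "?W \<in> orth_group" using V s s' by (intro orth_group_compose)
    moreover have "?W (\<iota> p x) = \<iota> p (G (Suc n) p x)" for p x
      by (cases p) (simp add: s(2) s'(2) V(2) G_def algebra_simps)
    moreover have "l ?W \<le> l s' + (l V + l s)"
      using l_comp[OF s'(1) orth_group_compose[OF V(1) s(1)]] l_comp[OF V(1) s(1)] by simp
    then have "l ?W \<le> real (Suc n) * (l s + l s') + l u"
      using V(3) by (simp add: algebra_simps)
    ultimately show ?case by blast
  qed
  show ?thesis
  proof (rule that[of "2 * (l s + l s')" "2 * l u + l T + l T'"]; (intro allI ballI impI)?)
    show "0 \<le> 2 * (l s + l s')" "0 \<le> 2 * l u + l T + l T'"
      using s(1) s'(1) u(1) T(1) T'(1) by (simp_all add: l_nonneg)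
    fix n U assume "U \<in> pointwise_stabilizer other_copies"
      and "\<forall>x. U (\<iota> (0,0) x) = \<iota> (0,0) (g n x)"
    then have U: "U \<in> orth_group" "\<And>x. U (\<iota> (0,0) x) = \<iota> (0,0) (g n x)"
        "\<And>i x. i \<noteq> (0,0) \<Longrightarrow> U (\<iota> i x) = \<iota> i x"
      by (auto simp: pointwise_stabilizer_def)
    obtain V where V: "V \<in> orth_group" "\<And>p x. V (\<iota> p x) = \<iota> p (G n p x)"
      "l V \<le> real n * (l s + l s') + l u" using conj by blast
    have V'I: "opinv V \<in> orth_group" using V(1) by (rule orth_group_inv)
    have V': "opinv V (\<iota> p (G n p x)) = \<iota> p x" for p x
      using V(2) orth_group_inv_apply(2)[OF V(1)] by metis
    let ?W = "V \<circ> (T \<circ> (opinv V \<circ> T'))"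
    have W: "?W \<in> orth_group" "opinv V \<circ> T' \<in> orth_group" "T \<circ> (opinv V \<circ> T') \<in> orth_group"
      using V(1) V'I T(1) T'(1) by (simp_all add: orth_group_compose)
    have "U = ?W"
    proof (rule copies_eqI)
      show "lin_isom U" "lin_isom ?W" using U(1) W(1) by (simp_all add: orth_group_lin_isom)
      fix p :: "int \<times> int" and x :: 'a
      obtain m j where p: "p = (m,j)" by (cases p)
      define j' where "j' = (if m = 0 then j - 1 else j)"
      obtain y where y: "x = G n (m,j') y"
        using G[of n "(m,j')"] by (auto simp: orth_group_def surj_def)
      have "?W (\<iota> p x) = V (T (opinv V (\<iota> (m,j') x)))"
        by (simp add: p T'(2) j'_def)
      also have "\<dots> = V (T (\<iota> (m,j') y))" by (simp only: y V')
      also have "\<dots> = \<iota> (m,j) (G n (m,j) y)"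
        by (simp add: T(2) V(2) j'_def)
      finally have Wp: "?W (\<iota> p x) = \<iota> (m,j) (G n (m,j) y)" .
      show "U (\<iota> p x) = ?W (\<iota> p x)"
      proof (cases "p = (0,0)")
        case True
        then show ?thesis using U(2)[of x] Wp y by (simp add: p j'_def G_def)
      next
        case False
        then have "G n (m,j) y = x"
          using y by (auto simp: p j'_def G_def)
        then show ?thesis using U(3)[OF False] Wp p by simp
      qed
    qed
    moreover have "l ?W \<le> l V + (l T + (l (opinv V) + l T'))"
      using l_comp[OF V(1) W(3)] l_comp[OF T(1) W(2)] l_comp[OF V'I T'(1)] by simp
    ultimately show "l U \<le> real n * (2 * (l s + l s')) + (2 * l u + l T + l T')"
      using l_inv[OF V(1)] V(3) by (simp add: algebra_simps)
  qed
qed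

text \<open>If \<open>l\<close> were unbounded, there would be operators \<open>U\<^sub>n\<close> with \<open>l(U\<^sub>n) > n\<^sup>2\<close>, against the linear bound
  for the sequence of their blocks.\<close>

lemma bounded_on_copy: "\<exists>M. \<forall>U\<in>pointwise_stabilizer other_copies. l U \<le> M"
proof (rule ccontr)
  assume "\<not> ?thesis"
  then have "\<forall>n::nat. \<exists>U. U \<in> pointwise_stabilizer other_copies \<and> \<not> l U \<le> real n * real n"
    by blast
  from choice[OF this] obtain U where U0: "\<And>n::nat. U n \<in> pointwise_stabilizer other_copies"
    "\<And>n. \<not> l (U n) \<le> real n * real n" by blast
  have U: "U n \<in> orth_group" "i \<noteq> (0,0) \<Longrightarrow> U n (\<iota> i x) = \<iota> i x" for n i x
    using U0(1)[of n] by (auto simp: pointwise_stabilizer_def)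
  have "\<forall>n. \<exists>g. g \<in> orth_group \<and> (\<forall>x. U n (\<iota> (0,0) x) = \<iota> (0,0) (g x))"
  proof
    fix n
    obtain g where "g \<in> orth_group" "\<And>x. U n (\<iota> (0,0) x) = \<iota> (0,0) (g x)"
      using fix_other_copies[OF U(1)[of n], of "(0,0)"] U(2) by blast
    then show "\<exists>g. g \<in> orth_group \<and> (\<forall>x. U n (\<iota> (0,0) x) = \<iota> (0,0) (g x))" by blast
  qed
  from choice[OF this] obtain g where g: "\<And>n. g n \<in> orth_group" "\<And>n x. U n (\<iota> (0,0) x) = \<iota> (0,0) (g n x)"
    by blast
  obtain c d where cd: "0 \<le> c" "0 \<le> d"
    "\<forall>n. \<forall>U\<in>pointwise_stabilizer other_copies.
      (\<forall>x. U (\<iota> (0,0) x) = \<iota> (0,0) (g n x)) \<longrightarrow> l U \<le> real n * c + d"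
    by (rule commutator_trick[of g, OF g(1)])
  obtain n :: nat where n: "real n \<ge> c + d + 1" using real_arch_simple by blast
  have "real n * real n < real n * c + d"
    using U0(2)[of n] cd(3)[rule_format, OF U0(1), of n n] g(2) by fastforce
  moreover have "real n * (c + d + 1) \<le> real n * real n"
    using n by (intro mult_left_mono) auto
  moreover have "d * 1 \<le> d * real n"
    using cd n by (intro mult_left_mono) auto
  ultimately show False by (simp add: algebra_simps)
qed

end

lemma subspace_orth_not_finite:
  fixes V :: "'a::real_inner set"
  assumes "finite F" "subspace V" "\<not> (\<exists>S. finite S \<and> V \<subseteq> span S)"
  shows "\<not> (\<exists>S. finite S \<and> {v\<in>V. \<forall>f\<in>F. inner v f = 0} \<subseteq> span S)"
  using assms(1)
proof (induction F)
  case empty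
  then show ?case using assms(3) by simp
next
  case (insert f F)
  let ?W = "{v\<in>V. \<forall>f\<in>F. inner v f = 0}"
  let ?W' = "{v\<in>V. \<forall>f\<in>insert f F. inner v f = 0}"
  show ?case
  proof (cases "\<exists>w\<in>?W. inner w f \<noteq> 0")
    case False
    then have "?W' = ?W" by auto
    then show ?thesis using insert.IH by simp
  next
    case True
    then obtain w where w: "w \<in> ?W" "inner w f \<noteq> 0" by blast
    show ?thesis
    proof
      assume "\<exists>S. finite S \<and> ?W' \<subseteq> span S"
      then obtain S where S: "finite S" "?W' \<subseteq> span S" by blast
      have "v \<in> span (insert w S)" if v: "v \<in> ?W" for v
      proof -
        define t where "t = inner v f / inner w f"
        have "v - t *\<^sub>R w \<in> ?W'"
          using v w assms(2) by (auto simp: t_def inner_diff_left subspace_diff subspace_scale)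
        then have "v - t *\<^sub>R w \<in> span (insert w S)"
          using S(2) span_mono[of S "insert w S"] by blast
        moreover have "t *\<^sub>R w \<in> span (insert w S)"
          by (intro span_scale span_base) simp
        ultimately show ?thesis
          using span_add by fastforce
      qed
      then show False using insert.IH S(1) by blast
    qed
  qed
qed

lemma unit_vector_orth:
  fixes \<alpha> :: "nat \<Rightarrow> 'a::real_inner"
  assumes "orthonormal \<alpha>" "finite F"
  obtains v where "v \<in> span (range \<alpha>)" "norm v = 1" "\<And>f. f \<in> F \<Longrightarrow> inner v f = 0"
proof -
  have "\<not> (\<exists>S. finite S \<and> span (range \<alpha>) \<subseteq> span S)"
  proof
    assume "\<exists>S. finite S \<and> span (range \<alpha>) \<subseteq> span S"
    then obtain S where S: "finite S" "span (range \<alpha>) \<subseteq> span S" by blast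
    have "range \<alpha> \<subseteq> span S" using S(2) span_superset[of "range \<alpha>"] by (rule subset_trans[rotated])
    then have "finite (range \<alpha>)"
      using independent_span_bound[OF S(1) orthonormal_imp_independent(2)[OF assms(1)]] by blast
    then show False
      using orthonormal_imp_independent(1)[OF assms(1)] by (simp add: finite_image_iff)
  qed
  then have *: "\<not> (\<exists>S. finite S \<and> {v\<in>span (range \<alpha>). \<forall>f\<in>F. inner v f = 0} \<subseteq> span S)"
    by (rule subspace_orth_not_finite[OF assms(2) subspace_span])
  have "\<not> {v\<in>span (range \<alpha>). \<forall>f\<in>F. inner v f = 0} \<subseteq> span {}"
    using * finite.emptyI by blast
  then obtain v where v: "v \<in> span (range \<alpha>)" "\<forall>f\<in>F. inner v f = 0" "v \<noteq> 0" by auto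
  show ?thesis
    by (rule that[of "v /\<^sub>R norm v"]) (use v in \<open>auto intro: span_scale\<close>)
qed

text \<open>Inside the spans of \<open>\<alpha>\<close> and \<open>\<beta>\<close>, \<open>g\<close> can be made to send an infinite-dimensional subspace of the first
  into the orthogonal complement of an infinite-dimensional subspace of the second: choose the vectors
  recursively, each orthogonal to the finitely many vectors in question that precede it.\<close>

lemma orthonormal_sequences:
  fixes \<alpha> \<beta> :: "nat \<Rightarrow> 'a::real_inner"
  assumes \<alpha>: "orthonormal \<alpha>" and \<beta>: "orthonormal \<beta>" and g: "g \<in> orth_group"
  obtains a b :: "nat \<Rightarrow> 'a" where "orthonormal a" "orthonormal b"
    "range a \<subseteq> span (range \<alpha>)" "range b \<subseteq> span (range \<beta>)" "\<forall>i j. inner (g (a i)) (b j) = 0"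
proof -
  define P where "P f n r \<longleftrightarrow>
    fst r \<in> span (range \<alpha>) \<and> norm (fst r) = 1 \<and>
    snd r \<in> span (range \<beta>) \<and> norm (snd r) = 1 \<and> inner (snd r) (g (fst r)) = 0 \<and>
    (\<forall>i<n. inner (fst r) (fst (f i)) = 0 \<and> inner (fst r) (opinv g (snd (f i))) = 0 \<and>
           inner (snd r) (snd (f i)) = 0 \<and> inner (snd r) (g (fst (f i))) = 0)"
    for f :: "nat \<Rightarrow> 'a \<times> 'a" and n :: nat and r :: "'a \<times> 'a"
  have "\<exists>f. \<forall>n. P f n (f n)"
  proof (rule dependent_wellorder_choice)
    show "P f n r = P h n r" if "\<And>m. m < n \<Longrightarrow> f m = h m" for r f h n
      using that by (simp add: P_def)
    fix n :: nat and f :: "nat \<Rightarrow> 'a \<times> 'a"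
    obtain v where v: "v \<in> span (range \<alpha>)" "norm v = 1"
      "\<And>x. x \<in> (\<lambda>i. fst (f i)) ` {..<n} \<union> (\<lambda>i. opinv g (snd (f i))) ` {..<n} \<Longrightarrow> inner v x = 0"
      by (rule unit_vector_orth[OF \<alpha>, of "(\<lambda>i. fst (f i)) ` {..<n} \<union> (\<lambda>i. opinv g (snd (f i))) ` {..<n}"])
        simp_all
    obtain w where w: "w \<in> span (range \<beta>)" "norm w = 1"
      "\<And>x. x \<in> insert (g v) ((\<lambda>i. snd (f i)) ` {..<n} \<union> (\<lambda>i. g (fst (f i))) ` {..<n}) \<Longrightarrow> inner w x = 0"
      by (rule unit_vector_orth[OF \<beta>, of "insert (g v) ((\<lambda>i. snd (f i)) ` {..<n} \<union> (\<lambda>i. g (fst (f i))) ` {..<n})"])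
        simp_all
    have "P f n (v, w)" using v w by (simp add: P_def)
    then show "\<exists>r. P f n r" ..
  qed
  then obtain f where f: "\<And>n. P f n (f n)" by blast
  define a b where "a n = fst (f n)" and "b n = snd (f n)" for n
  have lin: "inner (g x) (g y) = inner x y" for x y
    using g by (simp add: orth_group_lin_isom lin_isom_inner)
  have adj: "inner (g x) y = inner x (opinv g y)" for x y
    using lin[of x "opinv g y"] orth_group_inv_apply(1)[OF g] by simp
  have 1: "inner (a n) (a i) = 0" "inner (b n) (b i) = 0" "inner (g (a n)) (b i) = 0" "inner (g (a i)) (b n) = 0"
    if "i < n" for i n
    using f[of n] that by (auto simp: P_def a_def b_def adj inner_commute[of "snd _" "g _"])
  have 2: "norm (a n) = 1" "norm (b n) = 1" "inner (g (a n)) (b n) = 0" for n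
    using f[of n] by (auto simp: P_def a_def b_def inner_commute)
  have 3: "inner (a i) (a j) = 0" "inner (b i) (b j) = 0" if "i \<noteq> j" for i j
    using 1(1,2)[of i j] 1(1,2)[of j i] that by (auto simp: neq_iff inner_commute)
  show ?thesis
  proof (rule that[of a b])
    show "orthonormal a" "orthonormal b"
      unfolding orthonormal_def using 2 3 by (auto simp: norm_eq_1)
    have "inner (g (a i)) (b j) = 0" for i j
      using 1(3,4) 2(3) by (cases i j rule: linorder_cases) auto
    then show "\<forall>i j. inner (g (a i)) (b j) = 0" by blast
  qed (use f in \<open>auto simp: P_def a_def b_def\<close>)
qed

lemma orthonormal_reindex: "orthonormal e \<Longrightarrow> inj \<sigma> \<Longrightarrow> orthonormal (\<lambda>i. e (\<sigma> i))"
  by (auto simp: orthonormal_def inj_eq)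

lemma orthonormal_case_sum:
  assumes "orthonormal x" "orthonormal y" "\<And>i j. inner (x i) (y j) = 0"
  shows "orthonormal (case_sum x y)"
  unfolding orthonormal_def
proof (intro allI)
  fix i j
  show "inner (case_sum x y i) (case_sum x y j) = of_bool (i = j)"
    using assms by (cases i; cases j) (auto simp: orthonormal_def inner_commute)
qed

lemma inner_span_zero:
  assumes "v \<in> span S" "\<And>s. s \<in> S \<Longrightarrow> inner s y = 0" shows "inner v y = 0"
proof -
  have "span S \<subseteq> {x. inner x y = 0}"
    using assms(2) by (intro span_minimal closed_orth) auto
  then show ?thesis using assms(1) by blast
qed

locale separable_hilbert_length = separable_hilbert D + length_function l
  for D :: "'a::{real_inner,complete_space} set" and l :: "('a \<Rightarrow> 'a) \<Rightarrow> real"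
begin

lemma bounded_on_stabilizer_nat:
  fixes x z :: "nat \<Rightarrow> 'a"
  assumes x: "orthonormal x" "orthonormal z" "\<And>i n. inner (x i) (z n) = 0"
  shows "\<exists>M. \<forall>U\<in>pointwise_stabilizer (range x). l U \<le> M"
proof -
  obtain e :: "(int \<times> int) \<times> nat \<Rightarrow> 'a" where e: "orthonormal e" "complete_fam e"
    using basis_exists[where 'i = "(int \<times> int) \<times> nat"] by (auto simp: finite_prod)
  obtain b :: "nat \<Rightarrow> 'a" where b: "orthonormal b" "complete_fam b"
    using basis_exists[where 'i = nat] by auto
  have "\<exists>U. lin_isom U \<and> (\<forall>k. U (b k) = e (i,k))" for i
  proof -
    have "inj (Pair i :: nat \<Rightarrow> _)" by (simp add: inj_def)
    then show ?thesis
      using lin_isom_exists[OF b orthonormal_reindex[OF e(1), of "Pair i"]] by blast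
  qed
  then have "\<forall>i. \<exists>U. lin_isom U \<and> (\<forall>k. U (b k) = e (i,k))" by blast
  from choice[OF this] obtain \<iota> where \<iota>: "\<And>i. lin_isom (\<iota> i)" "\<And>i k. \<iota> i (b k) = e (i,k)" by blast
  interpret copies_length \<iota> b l
    by unfold_locales (use b \<iota> e in \<open>auto simp: case_prod_unfold\<close>)
  obtain M where M: "\<forall>U\<in>pointwise_stabilizer other_copies. l U \<le> M"
    using bounded_on_copy by (rule exE)
  let ?N = "{p :: (int \<times> int) \<times> nat. fst p \<noteq> (0,0)}"
  have "infinite ?N"
  proof
    assume "finite ?N"
    moreover have "range (\<lambda>k::nat. (((1::int),(0::int)),k)) \<subseteq> ?N" by auto
    ultimately have "finite (range (\<lambda>k::nat. (((1::int),(0::int)),k)))" by (rule rev_finite_subset)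
    then show False by (simp add: finite_image_iff inj_on_def)
  qed
  then have s: "bij_betw (from_nat_into ?N) UNIV ?N"
    by (intro bij_betw_from_nat_into) auto
  let ?\<sigma> = "from_nat_into ?N"
  have s': "inj ?\<sigma>" "\<And>n. fst (?\<sigma> n) \<noteq> (0,0)"
    using s by (auto simp: bij_betw_def)
  obtain V where V: "V \<in> orth_group" "\<And>n. V (x n) = e (?\<sigma> n)"
  proof (rule orth_group_extends[OF x])
    show "orthonormal (\<lambda>n. e (?\<sigma> n))" by (rule orthonormal_reindex[OF e(1) s'(1)])
    show "orthonormal (\<lambda>k. e ((0,0),k))"
      by (rule orthonormal_reindex[OF e(1)]) (simp add: inj_def)
    show "inner (e (?\<sigma> n)) (e ((0,0),k)) = 0" for n k
    proof -
      have "?\<sigma> n \<noteq> ((0,0),k)" using s'(2)[of n] by (metis fst_conv)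
      then show ?thesis using e(1) unfolding orthonormal_def by (metis of_bool_eq(1))
    qed
  qed blast
  have V': "opinv V \<in> orth_group" "V (opinv V y) = y" "opinv V (V y) = y" for y
    using V(1) by (simp_all add: orth_group_inv orth_group_inv_apply)
  have "l U \<le> M + 2 * l V" if "U \<in> pointwise_stabilizer (range x)" for U
  proof -
    have U: "U \<in> orth_group" "\<And>n. U (x n) = x n"
      using that by (auto simp: pointwise_stabilizer_def)
    let ?W = "V \<circ> (U \<circ> opinv V)"
    have W: "?W \<in> orth_group" using V(1) V'(1) U(1) by (simp add: orth_group_compose)
    have We: "?W (e (i,k)) = e (i,k)" if "i \<noteq> (0,0)" for i k
    proof -
      have "(i,k) \<in> ?N" using that by simp
      then obtain n where "(i,k) = ?\<sigma> n"
        using s unfolding bij_betw_def by (metis image_iff)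
      then show ?thesis using V(2)[of n] V'(3)[of "x n"] U(2)[of n] by simp
    qed
    have "?W (\<iota> i y) = \<iota> i y" if "i \<noteq> (0,0)" for i y
    proof -
      have "?W \<circ> \<iota> i = \<iota> i"
      proof (rule lin_isom_eqI[OF b(2)])
        show "lin_isom (?W \<circ> \<iota> i)" by (rule lin_isom_compose[OF orth_group_lin_isom[OF W] \<iota>(1)])
        show "(?W \<circ> \<iota> i) (b k) = \<iota> i (b k)" for k using We[OF that] \<iota>(2) by simp
      qed (rule \<iota>(1))
      then show ?thesis by (metis comp_apply)
    qed
    then have "?W \<in> pointwise_stabilizer other_copies"
      using W by (auto simp: pointwise_stabilizer_def)
    then have "l ?W \<le> M" using M by blast
    have "U = opinv V \<circ> (?W \<circ> V)" by (simp add: fun_eq_iff V')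
    then have "l U \<le> l (opinv V) + (l ?W + l V)"
      using l_comp[OF V'(1) orth_group_compose[OF W V(1)]] l_comp[OF W V(1)] by simp
    then show ?thesis using l_inv[OF V(1)] \<open>l ?W \<le> M\<close> by simp
  qed
  then show ?thesis by blast
qed

lemma bounded_on_stabilizer:
  fixes x :: "'i \<Rightarrow> 'a" and z :: "nat \<Rightarrow> 'a"
  assumes "countable (UNIV :: 'i set)" "infinite (UNIV :: 'i set)"
    and x: "orthonormal x" "orthonormal z" "\<And>i n. inner (x i) (z n) = 0"
  shows "\<exists>M. \<forall>U\<in>pointwise_stabilizer (range x). l U \<le> M"
proof -
  let ?\<sigma> = "from_nat_into (UNIV :: 'i set)"
  have "bij ?\<sigma>" using assms(1,2) by (rule bij_betw_from_nat_into)
  then have "orthonormal (\<lambda>n. x (?\<sigma> n))"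
    by (rule orthonormal_reindex[OF x(1) bij_is_inj])
  then have "\<exists>M. \<forall>U\<in>pointwise_stabilizer (range (\<lambda>n. x (?\<sigma> n))). l U \<le> M"
    by (rule bounded_on_stabilizer_nat[OF _ x(2,3)])
  moreover have "range (\<lambda>n. x (?\<sigma> n)) = range x"
    using \<open>bij ?\<sigma>\<close> by (metis bij_is_surj fun.set_map image_image)
  ultimately show ?thesis by simp
qed

text \<open>Split a Hilbert basis into two infinite halves \<open>A\<close> and \<open>B\<close>, and each of these into two infinite
  halves, the first of which are \<open>A'\<close> and \<open>B'\<close>. Up to operators that fix \<open>B\<close> on the right and operators
  that fix \<open>A\<close> on the left, an orthogonal \<open>g\<close> sends \<open>A'\<close> into the orthogonal complement of \<open>B'\<close>. It then
  agrees on \<open>A'\<close> with an operator that fixes \<open>B'\<close>. Hence \<open>g = k' m q k\<^sup>-\<^sup>1\<close>, where \<open>k'\<close> fixes \<open>A\<close>, \<open>m\<close> fixes \<open>B'\<close>,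
  \<open>q\<close> fixes \<open>A'\<close> and \<open>k\<close> fixes \<open>B\<close>, and \<open>l\<close> is bounded on each of these four stabilizers.\<close>

theorem length_bounded: "\<exists>M. \<forall>U\<in>orth_group. l U \<le> M"
proof -
  have inf: "infinite (UNIV :: (bool \<times> nat) set)" "infinite (UNIV :: ((bool \<times> bool) \<times> nat) set)"
    by (simp_all add: finite_prod)
  obtain e :: "(bool \<times> bool) \<times> nat \<Rightarrow> 'a" where e: "orthonormal e" "complete_fam e"
    using basis_exists[OF _ inf(2)] by auto
  have ee: "inner (e p) (e q) = of_bool (p = q)" for p q
    using e(1) unfolding orthonormal_def by blast
  have oe: "orthonormal (\<lambda>k. e (c,k))" "orthonormal (\<lambda>(t,k). e ((s,t),k))" for c s
    by (auto simp: orthonormal_def ee)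
  \<comment> \<open>The first Boolean tells \<open>A\<close> from \<open>B\<close>; the second is \<open>False\<close> on the halves \<open>A'\<close> and \<open>B'\<close>,
     written \<open>?Ae\<close> and \<open>?Be\<close>.\<close>
  let ?A = "\<lambda>(t,k). e ((True,t),k)" let ?B = "\<lambda>(t,k). e ((False,t),k)"
  let ?Ae = "\<lambda>k. e ((True,False),k)" let ?Be = "\<lambda>k. e ((False,False),k)"
  have "\<exists>M. \<forall>U\<in>pointwise_stabilizer (range (?A)). l U \<le> M"
    by (rule bounded_on_stabilizer[OF _ inf(1) oe(2)[of True] oe(1)[of "(False,False)"]]) (auto simp: ee)
  then obtain MA where MA0: "\<forall>U\<in>pointwise_stabilizer (range (?A)). l U \<le> MA" by (rule exE)
  have MA: "l U \<le> MA" if "U \<in> orth_group" "\<And>i. U (?A i) = ?A i" for U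
    using MA0 that unfolding pointwise_stabilizer_def by blast
  have "\<exists>M. \<forall>U\<in>pointwise_stabilizer (range (?B)). l U \<le> M"
    by (rule bounded_on_stabilizer[OF _ inf(1) oe(2)[of False] oe(1)[of "(True,False)"]]) (auto simp: ee)
  then obtain MB where MB0: "\<forall>U\<in>pointwise_stabilizer (range (?B)). l U \<le> MB" by (rule exE)
  have MB: "l U \<le> MB" if "U \<in> orth_group" "\<And>i. U (?B i) = ?B i" for U
    using MB0 that unfolding pointwise_stabilizer_def by blast
  have "\<exists>M. \<forall>U\<in>pointwise_stabilizer (range (?Ae)). l U \<le> M"
    by (rule bounded_on_stabilizer_nat[OF oe(1)[of "(True,False)"] oe(1)[of "(False,False)"]]) (auto simp: ee)
  then obtain MA0 where MA00: "\<forall>U\<in>pointwise_stabilizer (range (?Ae)). l U \<le> MA0" by (rule exE)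
  have MA0: "l U \<le> MA0" if "U \<in> orth_group" "\<And>i. U (?Ae i) = ?Ae i" for U
    using MA00 that unfolding pointwise_stabilizer_def by blast
  have "\<exists>M. \<forall>U\<in>pointwise_stabilizer (range (?Be)). l U \<le> M"
    by (rule bounded_on_stabilizer_nat[OF oe(1)[of "(False,False)"] oe(1)[of "(True,False)"]]) (auto simp: ee)
  then obtain MB0 where MB00: "\<forall>U\<in>pointwise_stabilizer (range (?Be)). l U \<le> MB0" by (rule exE)
  have MB0: "l U \<le> MB0" if "U \<in> orth_group" "\<And>i. U (?Be i) = ?Be i" for U
    using MB00 that unfolding pointwise_stabilizer_def by blast
  have "l g \<le> MA + (MB0 + (MA0 + MB))" if g: "g \<in> orth_group" for g
  proof -
    have \<tau>: "n = m" if "even n = even m" "n div 2 = m div 2" for n m :: nat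
      using that by presburger
    have oA: "orthonormal (\<lambda>n. e ((True, even n), n div 2))"
      and oB: "orthonormal (\<lambda>n. e ((False, even n), n div 2))"
      by (rule orthonormal_reindex[OF e(1)], rule injI, rule \<tau>, simp_all)+
    obtain a b :: "nat \<Rightarrow> 'a" where ab0: "orthonormal a" "orthonormal b"
      "range a \<subseteq> span (range (\<lambda>n. e ((True, even n), n div 2)))"
      "range b \<subseteq> span (range (\<lambda>n. e ((False, even n), n div 2)))"
      "\<forall>i j. inner (g (a i)) (b j) = 0"
      by (rule orthonormal_sequences[OF oA oB g])
    then have ab: "a i \<in> span (range (\<lambda>n. e ((True, even n), n div 2)))"
      "b i \<in> span (range (\<lambda>n. e ((False, even n), n div 2)))" "inner (g (a i)) (b j) = 0" for i j
      by blast+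
    have aB: "inner (a i) (?B p) = 0" for i p
      by (rule inner_span_zero[OF ab(1)]) (auto simp: ee split: prod.split)
    have bA: "inner (b i) (?A p) = 0" for i p
      by (rule inner_span_zero[OF ab(2)]) (auto simp: ee split: prod.split)
    have aa: "inner (a i) (a j) = of_bool (i = j)" and bb: "inner (b i) (b j) = of_bool (i = j)" for i j
      using ab0(1,2) unfolding orthonormal_def by blast+
    have ev: "orthonormal (\<lambda>i. a (2 * i))" "orthonormal (\<lambda>i. b (2 * i))"
      "orthonormal (\<lambda>i. a (2 * i + 1))" "orthonormal (\<lambda>i. b (2 * i + 1))"
      by (auto simp: orthonormal_def aa bb)
    have par: "2 * i \<noteq> 2 * j + 1" "2 * j + 1 \<noteq> 2 * i" for i j :: nat by presburger+
    \<comment> \<open>Only the vectors of even index are used; those of odd index witness that the complement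
       is infinite-dimensional.\<close>
    obtain k where k: "k \<in> orth_group" "\<And>i. k (case_sum ?Ae ?B i) = case_sum (\<lambda>i. a (2 * i)) ?B i"
    proof (rule orth_group_extends[of "case_sum ?Ae ?B" "\<lambda>k. e ((True,True),k)"
          "case_sum (\<lambda>i. a (2 * i)) ?B" "\<lambda>i. a (2 * i + 1)"])
      show "orthonormal (case_sum ?Ae ?B)" "orthonormal (case_sum (\<lambda>i. a (2 * i)) ?B)"
        using aB by (intro orthonormal_case_sum oe ev; force simp: ee)+
      show "inner (case_sum ?Ae ?B i) (e ((True,True),k)) = 0" for i k
        by (auto simp: ee split: sum.split prod.split)
      show "inner (case_sum (\<lambda>i. a (2 * i)) ?B i) (a (2 * n + 1)) = 0" for i n
        using aB[of "2 * n + 1"] par by (cases i) (auto simp: aa inner_commute)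
    qed (use oe(1) ev(3) in blast)+
    obtain k' where k': "k' \<in> orth_group" "\<And>i. k' (case_sum ?Be ?A i) = case_sum (\<lambda>i. b (2 * i)) ?A i"
    proof (rule orth_group_extends[of "case_sum ?Be ?A" "\<lambda>k. e ((False,True),k)"
          "case_sum (\<lambda>i. b (2 * i)) ?A" "\<lambda>i. b (2 * i + 1)"])
      show "orthonormal (case_sum ?Be ?A)" "orthonormal (case_sum (\<lambda>i. b (2 * i)) ?A)"
        using bA by (intro orthonormal_case_sum oe ev; force simp: ee)+
      show "inner (case_sum ?Be ?A i) (e ((False,True),k)) = 0" for i k
        by (auto simp: ee split: sum.split prod.split)
      show "inner (case_sum (\<lambda>i. b (2 * i)) ?A i) (b (2 * n + 1)) = 0" for i n
        using bA[of "2 * n + 1"] par by (cases i) (auto simp: bb inner_commute)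
    qed (use oe(1) ev(4) in blast)+
    have kA0: "k (?Ae i) = a (2 * i)" and kB: "k (?B p) = ?B p" for i p
      using k(2)[of "Inl i"] k(2)[of "Inr p"] by auto
    have kB0: "k' (?Be i) = b (2 * i)" and kA: "k' (?A p) = ?A p" for i p
      using k'(2)[of "Inl i"] k'(2)[of "Inr p"] by auto
    have k'i: "opinv k' \<in> orth_group" "k' (opinv k' y) = y" "opinv k' (k' y) = y" for y
      using k'(1) by (simp_all add: orth_group_inv orth_group_inv_apply)
    have ki: "opinv k \<in> orth_group" "k (opinv k y) = y" "opinv k (k y) = y" for y
      using k(1) by (simp_all add: orth_group_inv orth_group_inv_apply)
    define h where "h = opinv k' \<circ> g"
    have h: "h \<in> orth_group" unfolding h_def using k'i(1) g by (rule orth_group_compose)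
    have hi: "inner (h x) (h y) = inner x y" for x y
      using lin_isom_inner[OF orth_group_lin_isom[OF h]] .
    have hB0: "inner (h (a i)) (?Be j) = 0" for i j
    proof -
      have "inner (h (a i)) (?Be j) = inner (k' (h (a i))) (k' (?Be j))"
        using lin_isom_inner[OF orth_group_lin_isom[OF k'(1)]] by simp
      also have "\<dots> = 0" by (simp add: h_def k'i(2) kB0 ab(3))
      finally show ?thesis .
    qed
    obtain m where m: "m \<in> orth_group" "\<And>i. m (case_sum ?Ae ?Be i) = case_sum (\<lambda>i. h (a (2 * i))) ?Be i"
    proof (rule orth_group_extends[of "case_sum ?Ae ?Be" "\<lambda>k. e ((True,True),k)"
          "case_sum (\<lambda>i. h (a (2 * i))) ?Be" "\<lambda>i. h (a (2 * i + 1))"])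
      show "orthonormal (case_sum ?Ae ?Be)"
        by (intro orthonormal_case_sum oe) (simp add: ee)
      show "orthonormal (case_sum (\<lambda>i. h (a (2 * i))) ?Be)"
        by (intro orthonormal_case_sum oe hB0) (use ev(1) in \<open>simp add: orthonormal_def hi\<close>)
      show "orthonormal (\<lambda>i. h (a (2 * i + 1)))"
        using ev(3) by (simp add: orthonormal_def hi)
      show "inner (case_sum ?Ae ?Be i) (e ((True,True),k)) = 0" for i k
        by (auto simp: ee split: sum.split)
      show "inner (case_sum (\<lambda>i. h (a (2 * i))) ?Be i) (h (a (2 * n + 1))) = 0" for i n
        using hB0[of "2 * n + 1"] par by (cases i) (auto simp: hi aa inner_commute)
    qed (use oe(1) in blast)+
    have mA0: "m (?Ae i) = h (a (2 * i))" and mB0: "m (?Be i) = ?Be i" for i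
      using m(2)[of "Inl i"] m(2)[of "Inr i"] by auto
    have mi: "opinv m \<in> orth_group" "m (opinv m y) = y" "opinv m (m y) = y" for y
      using m(1) by (simp_all add: orth_group_inv orth_group_inv_apply)
    let ?q = "opinv m \<circ> (h \<circ> k)"
    have q: "?q \<in> orth_group" using mi(1) h k(1) by (simp add: orth_group_compose)
    have "l ?q \<le> MA0"
      using MA0[OF q] by (simp add: kA0 mi(3) flip: mA0)
    moreover have "l m \<le> MB0" using MB0[OF m(1)] mB0 by blast
    moreover have "l k' \<le> MA" using MA[OF k'(1)] kA by blast
    moreover have "l (opinv k) \<le> MB" using l_inv[OF k(1)] MB[OF k(1)] kB by fastforce
    moreover have "g = k' \<circ> (m \<circ> (?q \<circ> opinv k))"
      by (simp add: fun_eq_iff h_def ki mi k'i)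
    then have "l g \<le> l k' + (l m + (l ?q + l (opinv k)))"
      using l_comp[OF k'(1) orth_group_compose[OF m(1) orth_group_compose[OF q ki(1)]]]
        l_comp[OF m(1) orth_group_compose[OF q ki(1)]] l_comp[OF q ki(1)] by simp
    ultimately show ?thesis by linarith
  qed
  then show ?thesis by blast
qed

end

section \<open>Geometry of the hyperboloid\<close>

definition base_point :: "real \<times> 'h::real_inner"
  where "base_point = (1, 0)"

lemma base_point_hyp: "base_point \<in> hyp"
  by (simp add: base_point_def hyp_def lform_def)

lemma lform_base_point: "lform x base_point = fst x" "lform base_point x = fst x"
  by (simp_all add: base_point_def lform_def)

lemma hyp_sq:
  assumes "x \<in> hyp"
  shows "(fst x)\<^sup>2 = 1 + (norm (snd x))\<^sup>2" "fst x \<ge> 1" "norm (snd x) < fst x"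
proof -
  show 1: "(fst x)\<^sup>2 = 1 + (norm (snd x))\<^sup>2"
    using assms by (simp add: hyp_def lform_def dot_square_norm power2_eq_square[of "fst x"])
  have pos: "fst x > 0" using assms by (simp add: hyp_def)
  have "1\<^sup>2 \<le> (fst x)\<^sup>2" by (simp add: 1)
  then show "fst x \<ge> 1" using power2_le_imp_le[of 1 "fst x"] pos by simp
  have "(norm (snd x))\<^sup>2 < (fst x)\<^sup>2" by (simp add: 1)
  then show "norm (snd x) < fst x" using power2_less_imp_less[of "norm (snd x)" "fst x"] pos by simp
qed

lemma hyp_fst_bound:
  assumes x: "x \<in> hyp" and y: "y \<in> hyp"
  shows "fst y \<le> 2 * fst x * lform x y"
proof -
  define s t a b where "s = fst x" and "t = fst y" and "a = norm (snd x)" and "b = norm (snd y)"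
  have h: "s\<^sup>2 = 1 + a\<^sup>2" "s \<ge> 1" "a < s" "t \<ge> 1" "b < t" "0 \<le> a" "0 \<le> b"
    using hyp_sq[OF x] hyp_sq[OF y] by (simp_all add: s_def t_def a_def b_def)
  have "lform x y \<ge> s * t - a * b"
    using norm_cauchy_schwarz[of "snd x" "snd y"] by (simp add: lform_def s_def t_def a_def b_def)
  moreover have "a * b \<le> a * t" using h by (intro mult_left_mono) auto
  ultimately have "lform x y \<ge> t * (s - a)" by (simp add: algebra_simps)
  then have "2 * s * (t * (s - a)) \<le> 2 * s * lform x y"
    using h by (intro mult_left_mono) auto
  moreover have "1 = (s + a) * (s - a)"
    using h(1) by (simp add: power2_eq_square algebra_simps)
  moreover have "(s + a) * (s - a) \<le> (2 * s) * (s - a)"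
    using h by (intro mult_right_mono) auto
  ultimately have "1 \<le> (2 * s) * (s - a)" "t * ((2 * s) * (s - a)) \<le> 2 * s * lform x y"
    by (simp_all add: algebra_simps)
  moreover have "t * 1 \<le> t * ((2 * s) * (s - a))"
    using calculation(1) h by (intro mult_left_mono) auto
  ultimately show ?thesis by (simp add: s_def t_def)
qed

lemma lform_dist:
  assumes x: "x \<in> hyp" and y: "y \<in> hyp"
  shows "2 * (lform x y - 1) = (norm (snd x - snd y))\<^sup>2 - (fst x - fst y)\<^sup>2"
proof -
  have "(norm (snd x - snd y))\<^sup>2 = (norm (snd x))\<^sup>2 + (norm (snd y))\<^sup>2 - 2 * inner (snd x) (snd y)"
    by (simp add: power2_norm_eq_inner inner_diff_left inner_diff_right inner_commute)
  then show ?thesis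
    using hyp_sq(1)[OF x] hyp_sq(1)[OF y] by (simp add: lform_def power2_diff)
qed

lemma dist_sq_prod: "(dist x y)\<^sup>2 = (fst x - fst y)\<^sup>2 + (norm (snd x - snd y))\<^sup>2"
  for x y :: "real \<times> 'h::real_inner"
  by (simp add: dist_prod_def dist_norm)

lemma lform_le_dist:
  assumes x: "x \<in> hyp" and y: "y \<in> hyp"
  shows "lform x y \<le> 1 + (dist x y)\<^sup>2 / 2"
proof -
  have "2 * (lform x y - 1) \<le> (dist x y)\<^sup>2"
    using lform_dist[OF x y] dist_sq_prod[of x y] zero_le_power2[of "fst x - fst y"] by linarith
  then show ?thesis by simp
qed

lemma dist_le_lform:
  assumes x: "x \<in> hyp" and y: "y \<in> hyp"
  shows "(dist x y)\<^sup>2 \<le> 2 * (fst x + fst y)\<^sup>2 * (lform x y - 1)"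
proof -
  define s t a b N where "s = fst x" and "t = fst y" and "a = norm (snd x)" and "b = norm (snd y)"
    and "N = norm (snd x - snd y)"
  have h: "s\<^sup>2 = 1 + a\<^sup>2" "s \<ge> 1" "a < s" "t\<^sup>2 = 1 + b\<^sup>2" "t \<ge> 1" "b < t" "0 \<le> a" "0 \<le> b"
    using hyp_sq[OF x] hyp_sq[OF y] by (simp_all add: s_def t_def a_def b_def)
  have L: "2 * (lform x y - 1) = N\<^sup>2 - (s - t)\<^sup>2"
    using lform_dist[OF x y] by (simp add: s_def t_def N_def)
  have L0: "lform x y \<ge> 1" using lform_ge_1[OF x y] .
  have "(s - t) * (s + t) = (a - b) * (a + b)"
    using h by (simp add: power2_eq_square algebra_simps)
  then have "(s - t)\<^sup>2 * (s + t)\<^sup>2 = (a - b)\<^sup>2 * (a + b)\<^sup>2"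
    by (metis power_mult_distrib)
  also have "\<dots> \<le> N\<^sup>2 * (a + b)\<^sup>2"
  proof (intro mult_right_mono)
    have "\<bar>a - b\<bar> \<le> N" by (simp add: a_def b_def N_def norm_triangle_ineq3)
    then show "(a - b)\<^sup>2 \<le> N\<^sup>2" by (metis abs_ge_zero power2_abs power_mono)
  qed simp
  finally have 1: "(s - t)\<^sup>2 * (s + t)\<^sup>2 \<le> N\<^sup>2 * (a + b)\<^sup>2" .
  have 2: "(s + t)\<^sup>2 - (a + b)\<^sup>2 \<ge> 2"
  proof -
    have "a * b \<le> s * t" using h by (intro mult_mono) auto
    then show ?thesis using h(1,4) by (simp add: power2_sum)
  qed
  have "(s + t)\<^sup>2 * (2 * (lform x y - 1)) = N\<^sup>2 * (s + t)\<^sup>2 - (s - t)\<^sup>2 * (s + t)\<^sup>2"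
    unfolding L by (simp add: right_diff_distrib mult.commute)
  also have "\<dots> \<ge> N\<^sup>2 * ((s + t)\<^sup>2 - (a + b)\<^sup>2)"
    using 1 by (simp add: algebra_simps)
  moreover have "N\<^sup>2 * 2 \<le> N\<^sup>2 * ((s + t)\<^sup>2 - (a + b)\<^sup>2)"
    using 2 by (intro mult_left_mono) auto
  ultimately have 3: "N\<^sup>2 \<le> (s + t)\<^sup>2 * (lform x y - 1)" by linarith
  have "(s - t)\<^sup>2 \<le> N\<^sup>2" using L L0 by simp
  then have "(dist x y)\<^sup>2 \<le> 2 * N\<^sup>2"
    using dist_sq_prod[of x y] by (simp add: s_def t_def N_def)
  also have "\<dots> \<le> 2 * ((s + t)\<^sup>2 * (lform x y - 1))" using 3 by simp
  finally show ?thesis by (simp add: s_def t_def mult.assoc)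
qed

lemma hdist_nonneg: "0 \<le> hdist x y"
  using Metric_space.nonneg[OF Metric_space_hyp] .

lemma hdist_commute: "hdist x y = hdist y x"
  using Metric_space.commute[OF Metric_space_hyp] .

lemma hdist_triangle: "x \<in> hyp \<Longrightarrow> y \<in> hyp \<Longrightarrow> z \<in> hyp \<Longrightarrow> hdist x z \<le> hdist x y + hdist y z"
  using Metric_space.triangle[OF Metric_space_hyp] .

lemma hdist_less_iff: "x \<in> hyp \<Longrightarrow> y \<in> hyp \<Longrightarrow> 0 \<le> e \<Longrightarrow> hdist x y < e \<longleftrightarrow> lform x y < cosh e"
  using cosh_real_nonneg_less_iff[OF hdist_nonneg, of e x y] by (simp add: cosh_hdist)

lemma hdist_eq_iff:
  "x \<in> hyp \<Longrightarrow> y \<in> hyp \<Longrightarrow> x' \<in> hyp \<Longrightarrow> y' \<in> hyp \<Longrightarrow> hdist x y = hdist x' y' \<longleftrightarrow> lform x y = lform x' y'"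
  by (metis cosh_hdist hdist_def)

lemma cosh_gt_1: "0 < e \<Longrightarrow> 1 < cosh (e::real)"
  using cosh_real_nonneg_less_iff[of 0 e] by simp

text \<open>On the hyperboloid, the hyperbolic distance and the norm distance induce the same topology, but
  only the estimate of \<open>hdist\<close> by \<open>dist\<close> is uniform.\<close>

lemma dist_less_if_hdist_less:
  assumes x: "x \<in> hyp" and e: "e > 0"
  shows "\<exists>r>0. \<forall>y\<in>hyp. hdist x y < r \<longrightarrow> dist y x < e"
proof -
  define s where "s = fst x"
  have s: "s \<ge> 1" using hyp_sq(2)[OF x] by (simp add: s_def)
  define \<eta> where "\<eta> = min 1 (e\<^sup>2 / (50 * s\<^sup>2))"
  have \<eta>: "0 < \<eta>" "\<eta> \<le> 1" "50 * s\<^sup>2 * \<eta> \<le> e\<^sup>2"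
    using e s by (auto simp: \<eta>_def min_def field_simps)
  define r where "r = arcosh (1 + \<eta>)"
  have r: "r > 0" "cosh r = 1 + \<eta>" using \<eta> by (simp_all add: r_def)
  have "dist y x < e" if y: "y \<in> hyp" and d: "hdist x y < r" for y
  proof -
    have L: "lform x y < 1 + \<eta>" using d r hdist_less_iff[OF x y, of r] by simp
    have L1: "lform x y \<ge> 1" using lform_ge_1[OF x y] .
    have "fst y \<le> 2 * s * lform x y" using hyp_fst_bound[OF x y] by (simp add: s_def)
    also have "\<dots> \<le> 2 * s * 2" using L \<eta> s by (intro mult_left_mono) auto
    finally have "fst x + fst y \<le> 5 * s" by (simp add: s_def)
    then have "(fst x + fst y)\<^sup>2 \<le> (5 * s)\<^sup>2"
      using hyp_sq(2)[OF x] hyp_sq(2)[OF y] by (intro power_mono) auto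
    then have "2 * (fst x + fst y)\<^sup>2 * (lform x y - 1) \<le> 50 * s\<^sup>2 * (lform x y - 1)"
      using L1 by (intro mult_right_mono) (auto simp: power_mult_distrib)
    also have "\<dots> < 50 * s\<^sup>2 * \<eta>"
      using L s by (intro mult_strict_left_mono) auto
    finally have "(dist x y)\<^sup>2 < e\<^sup>2" using dist_le_lform[OF x y] \<eta>(3) by linarith
    then show ?thesis using power2_less_imp_less[of "dist x y" e] e by (simp add: dist_commute)
  qed
  then show ?thesis using r(1) by blast
qed

lemma hdist_less_if_dist_less:
  assumes e: "e > 0"
  shows "\<exists>r>0. \<forall>x\<in>hyp. \<forall>y\<in>hyp. dist x y < r \<longrightarrow> hdist x y < e"
proof -
  define r where "r = sqrt (2 * (cosh e - 1))"
  have r: "r > 0" "r\<^sup>2 = 2 * (cosh e - 1)"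
    using cosh_gt_1[OF e] by (simp_all add: r_def)
  have "hdist x y < e" if x: "x \<in> hyp" and y: "y \<in> hyp" and d: "dist x y < r" for x y :: "real \<times> 'a"
  proof -
    have "(dist x y)\<^sup>2 < r\<^sup>2" using d by (intro power_strict_mono) auto
    then have "lform x y < cosh e" using lform_le_dist[OF x y] r(2) by simp
    then show ?thesis using hdist_less_iff[OF x y, of e] e by simp
  qed
  then show ?thesis using r(1) by blast
qed

lemma hyp_topology_eq: "hyp_topology = top_of_set (hyp :: (real \<times> 'h::real_inner) set)"
proof -
  interpret H: Metric_space "hyp :: (real \<times> 'h) set" hdist by (rule Metric_space_hyp)
  show ?thesis
    unfolding hyp_topology_def
  proof (rule topology_eq[THEN iffD2], rule allI)
    fix U :: "(real \<times> 'h) set"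
    show "openin H.mtopology U = openin (top_of_set hyp) U"
    proof
      assume U: "openin H.mtopology U"
      show "openin (top_of_set hyp) U"
        unfolding openin_euclidean_subtopology_iff
      proof (intro conjI ballI)
        show "U \<subseteq> hyp" using U by (simp add: H.openin_mtopology)
        fix x assume xU: "x \<in> U"
        then have x: "x \<in> hyp" using \<open>U \<subseteq> hyp\<close> by blast
        obtain r where r: "r > 0" "H.mball x r \<subseteq> U"
          using U xU unfolding H.openin_mtopology by blast
        obtain e where e: "e > 0" "\<And>x y :: real \<times> 'h. x \<in> hyp \<Longrightarrow> y \<in> hyp \<Longrightarrow> dist x y < e \<Longrightarrow> hdist x y < r"
          using hdist_less_if_dist_less[OF r(1)] by blast
        have "y \<in> U" if "y \<in> hyp" "dist y x < e" for y
        proof -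
          have "hdist x y < r" using e(2)[OF x that(1)] that(2) by (simp add: dist_commute)
          then have "y \<in> H.mball x r" using x that(1) by simp
          then show ?thesis using r(2) by blast
        qed
        then show "\<exists>e>0. \<forall>x'\<in>hyp. dist x' x < e \<longrightarrow> x' \<in> U" using e(1) by blast
      qed
    next
      assume U: "openin (top_of_set hyp) U"
      then have Uh: "U \<subseteq> hyp" by (simp add: openin_euclidean_subtopology_iff)
      have "\<exists>r>0. H.mball x r \<subseteq> U" if xU: "x \<in> U" for x
      proof -
        have x: "x \<in> hyp" using Uh xU by blast
        obtain e where e: "e > 0" "\<forall>x'\<in>hyp. dist x' x < e \<longrightarrow> x' \<in> U"
          using U xU unfolding openin_euclidean_subtopology_iff by blast
        obtain r where r: "r > 0" "\<forall>y\<in>hyp. hdist x y < r \<longrightarrow> dist y x < e"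
          using dist_less_if_hdist_less[OF x e(1)] by blast
        have "H.mball x r \<subseteq> U" using e(2) r(2) by auto
        then show ?thesis using r(1) by blast
      qed
      then show "openin H.mtopology U" using Uh by (simp add: H.openin_mtopology)
    qed
  qed
qed

lemma tendsto_lform:
  "(f \<longlongrightarrow> a) F \<Longrightarrow> (g \<longlongrightarrow> b) F \<Longrightarrow> ((\<lambda>x. lform (f x) (g x)) \<longlongrightarrow> lform a b) F"
  unfolding lform_def by (intro tendsto_intros)

section \<open>Isometries and their linear extensions\<close>

lemma hyp_isometryD:
  assumes f: "f \<in> hyp_isometries"
  shows "f ` hyp = hyp" "x \<in> hyp \<Longrightarrow> f x \<in> hyp" "inj_on f hyp" "f \<in> extensional hyp"
    "x \<in> hyp \<Longrightarrow> y \<in> hyp \<Longrightarrow> hdist (f x) (f y) = hdist x y"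
    "x \<in> hyp \<Longrightarrow> y \<in> hyp \<Longrightarrow> lform (f x) (f y) = lform x y"
proof -
  show 1: "f ` hyp = hyp" "inj_on f hyp" "f \<in> extensional hyp"
    using f by (simp_all add: hyp_isometries_def Bij_def bij_betw_def)
  show 2: "x \<in> hyp \<Longrightarrow> f x \<in> hyp" for x using 1 by blast
  show 3: "x \<in> hyp \<Longrightarrow> y \<in> hyp \<Longrightarrow> hdist (f x) (f y) = hdist x y" for x y
    using f by (simp add: hyp_isometries_def)
  show "x \<in> hyp \<Longrightarrow> y \<in> hyp \<Longrightarrow> lform (f x) (f y) = lform x y"
    using 2[of x] 2[of y] 3[of x y] by (metis cosh_hdist)
qed

lemma hyp_isometryI:
  assumes "F ` hyp = hyp" "\<And>x y. x \<in> hyp \<Longrightarrow> y \<in> hyp \<Longrightarrow> lform (F x) (F y) = lform x y"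
  shows "restrict F hyp \<in> hyp_isometries"
proof -
  have F: "F x \<in> hyp" if "x \<in> hyp" for x using assms(1) that by blast
  have "inj_on F hyp"
  proof (rule inj_onI)
    fix x y assume xy: "x \<in> hyp" "y \<in> hyp" "F x = F y"
    then have "lform x y = 1"
      using assms(2)[OF xy(1,2)] F[OF xy(1)] by (simp add: hyp_def)
    then show "x = y" using lform_eq_1_iff[OF xy(1,2)] by simp
  qed
  then have "bij_betw (restrict F hyp) hyp hyp"
    using assms(1) by (simp add: bij_betw_def inj_on_restrict_eq)
  moreover have "hdist (F x) (F y) = hdist x y" if "x \<in> hyp" "y \<in> hyp" for x y
    using assms(2)[OF that] F that by (simp add: hdist_def)
  ultimately show ?thesis by (simp add: hyp_isometries_def Bij_def)
qed

lemma linear_ext: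
  assumes "f \<in> hyp_isometries"
  shows "linear (linear_ext f)" "lform (linear_ext f x) (linear_ext f y) = lform x y"
    "linear_ext f ` hyp = hyp" "x \<in> hyp \<Longrightarrow> linear_ext f x = f x"
proof -
  have "is_linear_ext f (linear_ext f)"
    unfolding linear_ext_def by (rule theI'[OF ex1_linear_ext[OF assms]])
  then show "linear (linear_ext f)" "lform (linear_ext f x) (linear_ext f y) = lform x y"
    "linear_ext f ` hyp = hyp" "x \<in> hyp \<Longrightarrow> linear_ext f x = f x"
    unfolding is_linear_ext_def by blast+
qed

lemma linear_eq_on_hyp:
  assumes "linear L" "linear L'" "\<And>x. x \<in> hyp \<Longrightarrow> L x = L' x"
  shows "L x = L' (x :: real \<times> 'h::real_inner)"
proof (rule linear_eq_on_span[OF assms(1,2), of hyp])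
  show "x \<in> span hyp" by (simp add: span_hyp)
qed (rule assms(3))

lemma Is_group_simps:
  "carrier Is_group = hyp_isometries"
  "f \<in> hyp_isometries \<Longrightarrow> g \<in> hyp_isometries \<Longrightarrow> f \<otimes>\<^bsub>Is_group\<^esub> g = compose hyp f g"
  "\<one>\<^bsub>Is_group\<^esub> = (\<lambda>x\<in>hyp. x)"
  by (auto simp: Is_group_def BijGroup_def hyp_isometries_def)

lemma compose_isometry:
  assumes "f \<in> hyp_isometries" "g \<in> hyp_isometries"
  shows "compose hyp f g \<in> hyp_isometries"
  using monoid.m_closed[OF group.is_monoid[OF group_Is_group], of f g] assms
  by (simp add: Is_group_simps)

lemma linear_ext_compose:
  assumes f: "f \<in> hyp_isometries" and g: "g \<in> hyp_isometries"
  shows "linear_ext (compose hyp f g) x = linear_ext f (linear_ext g x)"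
proof (rule linear_eq_on_hyp[where L' = "\<lambda>x. linear_ext f (linear_ext g x)"])
  show "linear (linear_ext (compose hyp f g))" by (rule linear_ext(1)[OF compose_isometry[OF f g]])
  show "linear (\<lambda>x. linear_ext f (linear_ext g x))"
    using linear_compose[OF linear_ext(1)[OF g] linear_ext(1)[OF f]] by (simp add: o_def)
  show "linear_ext (compose hyp f g) x = linear_ext f (linear_ext g x)" if "x \<in> hyp" for x
    using that linear_ext(4)[OF compose_isometry[OF f g]] linear_ext(4)[OF f] linear_ext(4)[OF g]
      hyp_isometryD(2)[OF g] by (simp add: compose_eq)
qed

lemma lform_cauchy:
  fixes x y :: "real \<times> 'h::real_inner" shows "\<bar>lform x y\<bar> \<le> 2 * (norm x * norm y)"
proof -
  have "\<bar>fst x * fst y\<bar> \<le> norm x * norm y"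
    using norm_fst_le[of "fst x" "snd x"] norm_fst_le[of "fst y" "snd y"]
    by (simp add: abs_mult mult_mono)
  moreover have "\<bar>inner (snd x) (snd y)\<bar> \<le> norm x * norm y"
    using Cauchy_Schwarz_ineq2[of "snd x" "snd y"] 
      mult_mono[of "norm (snd x)" "norm x" "norm (snd y)" "norm y"]
      norm_snd_le[of "snd x" "fst x"] norm_snd_le[of "snd y" "fst y"] by simp
  ultimately show ?thesis unfolding lform_def by linarith
qed

lemma norm_sq_lform: "(norm x)\<^sup>2 = 2 * (fst x)\<^sup>2 - lform x x"
  for x :: "real \<times> 'h::real_inner"
  by (simp add: norm_prod_def lform_def power2_norm_eq_inner power2_eq_square[of "fst x"])

text \<open>The norm of \<open>\<real> \<oplus> H\<close> is determined by the form \<open>lform\<close> and the base point (\<open>norm_sq_lform\<close>), so the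
  operator norm of an isometry is controlled by the displacement of the base point.\<close>

lemma linear_ext_norm_bound:
  assumes f: "f \<in> hyp_isometries"
  shows "norm (linear_ext f x) \<le> 6 * fst (f base_point) * norm x"
proof -
  let ?L = "linear_ext f"
  obtain q where q: "q \<in> hyp" "?L q = base_point"
    using linear_ext(3)[OF f] base_point_hyp by (metis imageE)
  have fb: "f base_point \<in> hyp" using hyp_isometryD(2)[OF f base_point_hyp] .
  have "fst q = lform (?L q) (?L base_point)"
    using linear_ext(2)[OF f, of q base_point] by (simp add: lform_base_point)
  also have "\<dots> = fst (f base_point)"
    using linear_ext(4)[OF f base_point_hyp] by (simp add: q(2) lform_base_point)
  finally have fq: "fst q = fst (f base_point)" .
  define c where "c = fst (f base_point)"
  have c: "c \<ge> 1" using hyp_sq(2)[OF fb] by (simp add: c_def)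
  have nq: "norm q \<le> 2 * c"
  proof (rule power2_le_imp_le)
    have "(norm q)\<^sup>2 \<le> 2 * c\<^sup>2"
      using q(1) by (simp add: norm_sq_lform fq c_def hyp_def)
    also have "\<dots> \<le> (2 * c)\<^sup>2" by (simp add: power_mult_distrib)
    finally show "(norm q)\<^sup>2 \<le> (2 * c)\<^sup>2" .
  qed (use c in auto)
  have "fst (?L x) = lform x q"
    using linear_ext(2)[OF f, of x q] by (simp add: q(2) lform_base_point)
  then have "\<bar>fst (?L x)\<bar> \<le> 2 * (norm x * norm q)"
    using lform_cauchy by metis
  also have "\<dots> \<le> 2 * (norm x * (2 * c))"
    using nq by (intro mult_left_mono) auto
  finally have "(fst (?L x))\<^sup>2 \<le> (4 * c * norm x)\<^sup>2"
    using c by (intro abs_le_square_iff[THEN iffD1]) (simp add: abs_mult mult_ac)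
  moreover have "- lform x x \<le> (norm x)\<^sup>2"
    using norm_sq_lform[of x] by simp
  ultimately have "(norm (?L x))\<^sup>2 \<le> 2 * (4 * c * norm x)\<^sup>2 + (norm x)\<^sup>2"
    using norm_sq_lform[of "?L x"] linear_ext(2)[OF f, of x x] by linarith
  also have "\<dots> \<le> (6 * c * norm x)\<^sup>2"
  proof -
    have "1 * (norm x)\<^sup>2 \<le> c\<^sup>2 * (norm x)\<^sup>2"
      using c by (intro mult_right_mono) auto
    moreover have "0 \<le> c\<^sup>2 * (norm x)\<^sup>2" by simp
    moreover have "(4 * c * norm x)\<^sup>2 = 16 * (c\<^sup>2 * (norm x)\<^sup>2)"
      "(6 * c * norm x)\<^sup>2 = 36 * (c\<^sup>2 * (norm x)\<^sup>2)"
      by (simp_all add: power_mult_distrib)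
    ultimately show ?thesis by linarith
  qed
  finally have "norm (?L x) \<le> 6 * c * norm x"
    by (rule power2_le_imp_le) (use c in simp)
  then show ?thesis by (simp add: c_def)
qed

section \<open>Two-point homogeneity\<close>

text \<open>The sign condition separates the two sheets of the hyperboloid.\<close>

lemma hyp_if_lform_pos:
  assumes w: "lform w w = 1" and u: "u \<in> hyp" "lform w u > 0" shows "w \<in> hyp"
proof -
  have "(fst w)\<^sup>2 = 1 + (norm (snd w))\<^sup>2"
    using w by (simp add: lform_def dot_square_norm power2_eq_square[of "fst w"])
  then have "(fst w)\<^sup>2 \<ge> 1" by simp
  then have "fst w \<noteq> 0" by auto
  moreover have "\<not> fst w < 0"
  proof
    assume that: "fst w < 0"
    have "lform (- w) (- w) = 1" "lform (- w) u = - lform w u"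
      using w by (simp_all add: lform_def)
    then have "- w \<in> hyp" using that by (simp add: hyp_def)
    from lform_ge_1[OF this u(1)] show False using u(2) \<open>lform (- w) u = - lform w u\<close> by simp
  qed
  ultimately have "fst w > 0" by linarith
  then show ?thesis using w by (simp add: hyp_def)
qed

text \<open>The Lorentz reflection along \<open>n = y - y'\<close> swaps \<open>y\<close> and \<open>y'\<close> and fixes the points equidistant from them.\<close>

lemma hyp_swap:
  assumes y: "y \<in> hyp" and y': "y' \<in> hyp"
  obtains g where "g \<in> hyp_isometries" "g y = y'"
    "\<forall>x\<in>hyp. lform x y = lform x y' \<longrightarrow> g x = x"
proof (cases "y = y'")
  case True
  have "restrict (\<lambda>x. x) hyp \<in> hyp_isometries" by (rule hyp_isometryI) auto
  then show ?thesis using that[of "restrict (\<lambda>x. x) hyp"] True y by simp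
next
  case False
  define n where "n = y - y'"
  define c where "c = lform n n"
  have yy: "lform y y = 1" "lform y' y' = 1" using y y' by (auto simp: hyp_def)
  have c: "c = 2 - 2 * lform y y'"
    by (simp add: c_def n_def lform_simps yy lform_commute[of y' y])
  have "lform y y' \<noteq> 1" using lform_eq_1_iff[OF y y'] False by simp
  then have c0: "c \<noteq> 0" by (simp add: c)
  define R where "R z = z - (2 * lform z n / c) *\<^sub>R n" for z
  have RR: "lform (R z) (R w) = lform z w" for z w
  proof -
    have "lform (R z) (R w) = lform z w - (2 * lform w n / c) * lform z n
        - (2 * lform z n / c) * lform n w + (2 * lform z n / c) * (2 * lform w n / c) * c"
      by (simp add: R_def lform_simps c_def[symmetric] algebra_simps)
    also have "\<dots> = lform z w"
      using c0 by (simp add: lform_commute[of n w] field_simps)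
    finally show ?thesis .
  qed
  have Rn: "lform (R z) n = - lform z n" for z
    using c0 by (simp add: R_def lform_simps c_def[symmetric])
  have inv: "R (R z) = z" for z
    by (simp add: R_def[of "R z"] Rn) (simp add: R_def)
  have "lform y n = 1 - lform y y'" by (simp add: n_def lform_simps yy)
  then have "2 * lform y n / c = 1" using c0 c by simp
  then have Ry: "R y = y'" by (simp add: R_def n_def)
  have Rh: "R z \<in> hyp" if z: "z \<in> hyp" for z
  proof (rule hyp_if_lform_pos[OF _ y'])
    show "lform (R z) (R z) = 1" using z by (simp add: RR hyp_def)
    have "lform (R z) y' = lform z y" using RR[of z y] by (simp add: Ry)
    then show "lform (R z) y' > 0" using lform_ge_1[OF z y] by simp
  qed
  have "z \<in> R ` hyp" if "z \<in> hyp" for z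
    using inv[of z] Rh[OF that] by (metis imageI)
  then have "R ` hyp = hyp" using Rh by blast
  then have "restrict R hyp \<in> hyp_isometries" by (rule hyp_isometryI) (rule RR)
  moreover have "restrict R hyp x = x" if "x \<in> hyp" "lform x y = lform x y'" for x
    using that by (simp add: R_def n_def lform_simps)
  ultimately show ?thesis using that[of "restrict R hyp"] y Ry by simp
qed

lemma two_point_homogeneous:
  assumes x: "x \<in> hyp" "y \<in> hyp" and x': "x' \<in> hyp" "y' \<in> hyp" and eq: "lform x y = lform x' y'"
  obtains g where "g \<in> hyp_isometries" "g x = x'" "g y = y'"
proof -
  obtain g where g: "g \<in> hyp_isometries" "g x = x'"
    using hyp_swap[OF x(1) x'(1)] by blast
  have gy: "g y \<in> hyp" using hyp_isometryD(2)[OF g(1) x(2)] .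
  obtain h where h: "h \<in> hyp_isometries" "h (g y) = y'"
    "\<forall>z\<in>hyp. lform z (g y) = lform z y' \<longrightarrow> h z = z"
    using hyp_swap[OF gy x'(2)] by blast
  have "lform x' (g y) = lform x' y'"
    using hyp_isometryD(6)[OF g(1) x] eq g(2) by simp
  then have "h x' = x'" using h(3) x'(1) by blast
  then show ?thesis
    using that[OF compose_isometry[OF h(1) g(1)]] x g(2) h(2) by (simp add: compose_eq)
qed

section \<open>Circumcenters\<close>

text \<open>The fixed point minimizes \<open>r z\<close>, the supremum of \<open>cosh (d(z, s))\<close> over \<open>s \<in> S\<close>. If \<open>x\<close> and \<open>y\<close> are
  almost minimizers, comparing with the midpoint \<open>m\<close> of \<open>x\<close> and \<open>y\<close> shows that \<open>x\<close> and \<open>y\<close> are close to each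
  other; this yields both existence and uniqueness of the minimizer.\<close>

lemma circumcenter:
  fixes S :: "(real \<times> 'h::{real_inner,complete_space}) set"
  assumes S: "S \<subseteq> hyp" "S \<noteq> {}" and R: "\<And>s. s \<in> S \<Longrightarrow> fst s \<le> R"
  obtains p where "p \<in> hyp" "\<forall>f\<in>hyp_isometries. f ` S = S \<longrightarrow> f p = p"
proof -
  define r where "r z = (SUP s\<in>S. lform z s)" for z
  have bdd: "bdd_above (lform z ` S)" if z: "z \<in> hyp" for z
  proof (rule bdd_aboveI2)
    fix s assume s: "s \<in> S"
    have "\<bar>lform z s\<bar> \<le> 2 * (norm z * norm s)" by (rule lform_cauchy)
    also have "norm s \<le> fst s + norm (snd s)"
      using norm_Pair_le[of "fst s" "snd s"] hyp_sq(2)[of s] S(1) s by auto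
    also have "\<dots> \<le> 2 * R" using hyp_sq(3)[of s] S(1) s R[OF s] by auto
    finally show "lform z s \<le> 2 * (norm z * (2 * R))" by (simp add: mult_left_mono)
  qed
  have le_r: "lform z s \<le> r z" if "z \<in> hyp" "s \<in> S" for z s
    unfolding r_def using that bdd by (intro cSUP_upper)
  have r_le: "r z \<le> c" if "\<And>s. s \<in> S \<Longrightarrow> lform z s \<le> c" for z c
    unfolding r_def using that S(2) by (intro cSUP_least)
  have r1: "r z \<ge> 1" if z: "z \<in> hyp" for z
  proof -
    obtain s where "s \<in> S" using S(2) by blast
    then show ?thesis
      using order_trans[OF lform_ge_1[OF z, of s] le_r[OF z, of s]] S(1) by blast
  qed
  define \<rho> where "\<rho> = (INF z\<in>hyp. r z)"
  have bddr: "bdd_below (r ` hyp)" using r1 by (rule bdd_belowI2)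
  have hyp_ne: "hyp \<noteq> ({} :: (real \<times> 'h) set)" using base_point_hyp by blast
  have \<rho>_le: "\<rho> \<le> r z" if "z \<in> hyp" for z
    unfolding \<rho>_def using bddr that by (rule cINF_lower)
  have \<rho>1: "\<rho> \<ge> 1"
    unfolding \<rho>_def using hyp_ne r1 by (rule cINF_greatest)
  \<comment> \<open>The bound comes from \<open>\<rho> \<le> r m \<le> 2 (\<rho> + \<epsilon>) / k\<close> at the midpoint \<open>m\<close>, with \<open>k\<^sup>2 = 2 + 2 lform x y\<close>.\<close>
  have mid: "lform x y - 1 \<le> 2 * ((1 + \<epsilon>)\<^sup>2 - 1)"
    if x: "x \<in> hyp" "r x \<le> \<rho> + \<epsilon>" and y: "y \<in> hyp" "r y \<le> \<rho> + \<epsilon>" and \<epsilon>: "\<epsilon> \<ge> 0" for x y \<epsilon>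
  proof -
    define L where "L = lform x y"
    have L: "L \<ge> 1" using lform_ge_1[OF x(1) y(1)] by (simp add: L_def)
    define k where "k = sqrt (2 + 2 * L)"
    have k: "k > 0" "k\<^sup>2 = 2 + 2 * L" using L by (simp_all add: k_def)
    define m where "m = (1 / k) *\<^sub>R (x + y)"
    have xy: "lform x x = 1" "lform y y = 1" "lform y x = L" "lform x y = L"
      using x(1) y(1) by (auto simp: hyp_def L_def lform_commute)
    have ms: "lform m s = (lform x s + lform y s) / k" for s
      by (simp add: m_def lform_simps)
    have "m \<in> hyp"
    proof (rule hyp_if_lform_pos[OF _ x(1)])
      have "lform m m = (2 + 2 * L) / k\<^sup>2"
        by (simp add: m_def lform_simps xy power2_eq_square add_divide_distrib)
      then show "lform m m = 1" using k L by simp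
      show "lform m x > 0" using L k by (simp add: ms xy)
    qed
    then have "\<rho> \<le> r m" by (rule \<rho>_le)
    also have "\<dots> \<le> 2 * (\<rho> + \<epsilon>) / k"
    proof (rule r_le)
      fix s assume "s \<in> S"
      then have "lform x s + lform y s \<le> 2 * (\<rho> + \<epsilon>)"
        using le_r[OF x(1)] le_r[OF y(1)] x(2) y(2) by fastforce
      then show "lform m s \<le> 2 * (\<rho> + \<epsilon>) / k"
        using k by (simp add: ms divide_right_mono)
    qed
    finally have "\<rho> * k \<le> 2 * (\<rho> + \<epsilon>)" using k by (simp add: field_simps)
    also have "\<rho> + \<epsilon> \<le> \<rho> * (1 + \<epsilon>)" using \<rho>1 \<epsilon> mult_right_mono[of 1 \<rho> \<epsilon>] by (simp add: algebra_simps)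
    finally have "\<rho> * k \<le> \<rho> * (2 * (1 + \<epsilon>))" by (simp only: mult_ac)
    then have "k \<le> 2 * (1 + \<epsilon>)" using \<rho>1 by simp
    then have "k\<^sup>2 \<le> (2 * (1 + \<epsilon>))\<^sup>2" using k by (intro power_mono) auto
    also have "(2 * (1 + \<epsilon>))\<^sup>2 = 4 * (1 + \<epsilon>)\<^sup>2"
      unfolding power_mult_distrib by simp
    finally show ?thesis using k(2) unfolding L_def by argo
  qed
  have "\<exists>z. z \<in> hyp \<and> r z < \<rho> + 1 / Suc n" for n
  proof -
    have "(INF z\<in>hyp. r z) < \<rho> + 1 / Suc n" by (simp add: \<rho>_def)
    then show ?thesis using cINF_less_iff[OF hyp_ne bddr] by blast
  qed
  then have "\<forall>n. \<exists>z. z \<in> hyp \<and> r z < \<rho> + 1 / Suc n" by blast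
  from choice[OF this] obtain z where z: "\<And>n. z n \<in> hyp" "\<And>n. r (z n) < \<rho> + 1 / Suc n" by blast
  obtain s0 where s0: "s0 \<in> S" using S(2) by blast
  then have s0h: "s0 \<in> hyp" using S(1) by blast
  define C where "C = 2 * fst s0 * (\<rho> + 1)"
  have zC: "fst (z n) \<le> C" for n
  proof -
    have "fst (z n) \<le> 2 * fst s0 * lform s0 (z n)" by (rule hyp_fst_bound[OF s0h z(1)])
    also have "lform s0 (z n) \<le> \<rho> + 1"
    proof -
      have "(1::real) / Suc n \<le> 1" by simp
      then show ?thesis
        using le_r[OF z(1)[of n] s0] z(2)[of n] lform_commute[of s0 "z n"] by linarith
    qed
    finally show ?thesis using hyp_sq(2)[OF s0h] by (simp add: C_def mult_left_mono)
  qed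
  have C1: "C \<ge> 1" using zC[of 0] hyp_sq(2)[OF z(1)[of 0]] by simp
  have dz: "(dist (z n) (z m))\<^sup>2 \<le> 48 * C\<^sup>2 * (1 / Suc N)" if "N \<le> n" "N \<le> m" for n m N
  proof -
    let ?e = "1 / real (Suc N)"
    have e: "0 \<le> ?e" "?e \<le> 1" by simp_all
    have "1 / real (Suc n) \<le> ?e" "1 / real (Suc m) \<le> ?e"
      using that by (simp_all add: frac_le)
    then have "r (z n) \<le> \<rho> + ?e" "r (z m) \<le> \<rho> + ?e"
      using z(2)[of n] z(2)[of m] by linarith+
    then have "lform (z n) (z m) - 1 \<le> 2 * ((1 + ?e)\<^sup>2 - 1)"
      using mid[OF z(1) _ z(1) _ e(1)] by blast
    also have "\<dots> \<le> 6 * ?e"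
    proof -
      have "?e * ?e \<le> ?e * 1" using e by (intro mult_left_mono) auto
      then show ?thesis by (simp add: power2_sum power2_eq_square algebra_simps del: of_nat_Suc)
    qed
    finally have 1: "lform (z n) (z m) - 1 \<le> 6 * ?e" .
    have "(fst (z n) + fst (z m))\<^sup>2 \<le> (2 * C)\<^sup>2"
      using zC[of n] zC[of m] hyp_sq(2)[OF z(1)[of n]] hyp_sq(2)[OF z(1)[of m]]
      by (intro power_mono) auto
    then have "(fst (z n) + fst (z m))\<^sup>2 * (lform (z n) (z m) - 1) \<le> (2 * C)\<^sup>2 * (6 * ?e)"
      using 1 lform_ge_1[OF z(1)[of n] z(1)[of m]] by (intro mult_mono) auto
    then show ?thesis
      using dist_le_lform[OF z(1)[of n] z(1)[of m]] by (simp add: power_mult_distrib)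
  qed
  have "Cauchy z"
  proof (rule metric_CauchyI)
    fix e :: real assume e: "e > 0"
    define t where "t = e\<^sup>2 / (48 * C\<^sup>2)"
    have t: "t > 0" using e C1 by (simp add: t_def)
    then obtain N where N: "inverse (real (Suc N)) < t"
      using reals_Archimedean by blast
    have "dist (z n) (z m) < e" if "N \<le> n" "N \<le> m" for n m
    proof -
      have "48 * C\<^sup>2 * (1 / Suc N) < 48 * C\<^sup>2 * t"
        using N C1 by (intro mult_strict_left_mono) (auto simp: inverse_eq_divide)
      also have "\<dots> = e\<^sup>2" using C1 by (simp add: t_def)
      finally have "(dist (z n) (z m))\<^sup>2 < e\<^sup>2" using dz[OF that] by simp
      then show ?thesis using power2_less_imp_less[of "dist (z n) (z m)" e] e by simp
    qed
    then show "\<exists>M. \<forall>m\<ge>M. \<forall>n\<ge>M. dist (z m) (z n) < e" by blast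
  qed
  then obtain p where p: "z \<longlonglongrightarrow> p"
    using Cauchy_convergent_iff convergent_def by blast
  have ph: "p \<in> hyp"
  proof -
    have "(\<lambda>n. lform (z n) (z n)) \<longlonglongrightarrow> lform p p" by (intro tendsto_lform p)
    moreover have "lform (z n) (z n) = 1" for n using z(1)[of n] by (simp add: hyp_def)
    ultimately have "lform p p = 1" using LIMSEQ_unique[OF _ tendsto_const[of 1]] by simp
    moreover have "fst p \<ge> 1"
      by (rule LIMSEQ_le_const[OF tendsto_fst[OF p]]) (use hyp_sq(2)[OF z(1)] in blast)
    ultimately show ?thesis by (simp add: hyp_def)
  qed
  have ps: "lform p s \<le> \<rho>" if s: "s \<in> S" for s
  proof (rule LIMSEQ_le)
    show "(\<lambda>n. lform (z n) s) \<longlonglongrightarrow> lform p s" by (intro tendsto_lform p tendsto_const)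
    have "(\<lambda>n. \<rho> + 1 / Suc n) \<longlonglongrightarrow> \<rho> + 0"
      by (intro tendsto_intros LIMSEQ_Suc[OF lim_1_over_n])
    then show "(\<lambda>n. \<rho> + 1 / Suc n) \<longlonglongrightarrow> \<rho>" by simp
    have "lform (z n) s \<le> \<rho> + 1 / Suc n" for n
      using le_r[OF z(1)[of n] s] z(2)[of n] by linarith
    then show "\<exists>N. \<forall>n\<ge>N. lform (z n) s \<le> \<rho> + 1 / Suc n" by blast
  qed
  have "f p = p" if f: "f \<in> hyp_isometries" "f ` S = S" for f
  proof -
    have fp: "f p \<in> hyp" using hyp_isometryD(2)[OF f(1) ph] .
    have "lform (f p) s \<le> \<rho>" if s: "s \<in> S" for s
    proof -
      obtain s' where s': "s' \<in> S" "s = f s'" using f(2) s by blast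
      then have "lform (f p) s = lform p s'"
        using hyp_isometryD(6)[OF f(1) ph, of s'] S(1) by blast
      then show ?thesis using ps[OF s'(1)] by simp
    qed
    then have "r (f p) \<le> \<rho> + 0" "r p \<le> \<rho> + 0" using r_le ps by auto
    then have "lform (f p) p - 1 \<le> 2 * ((1 + 0)\<^sup>2 - 1)"
      by (intro mid fp ph) auto
    then have "lform (f p) p = 1" using lform_ge_1[OF fp ph] by simp
    then show ?thesis using lform_eq_1_iff[OF fp ph] by simp
  qed
  then show ?thesis using that[OF ph] by blast
qed

section \<open>Rotations about the base point\<close>

text \<open>The isometry that an orthogonal operator \<open>U\<close> of \<open>H\<close> induces on the hyperboloid. By
  \<open>stabilizer_base_point\<close>, these are all isometries fixing the base point.\<close>

definition rotation :: "('h::real_inner \<Rightarrow> 'h) \<Rightarrow> real \<times> 'h \<Rightarrow> real \<times> 'h"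
  where "rotation U = (\<lambda>x\<in>hyp. (fst x, U (snd x)))"

lemma rotation_isometry:
  assumes U: "U \<in> orth_group" shows "rotation U \<in> hyp_isometries"
  unfolding rotation_def
proof (rule hyp_isometryI)
  have 1: "(fst x, V (snd x)) \<in> hyp" if "V \<in> orth_group" "x \<in> hyp" for V and x :: "real \<times> 'a"
    using that lin_isom_inner[OF orth_group_lin_isom[OF that(1)]] by (simp add: hyp_def lform_def)
  show "(\<lambda>x. (fst x, U (snd x))) ` hyp = hyp"
  proof
    show "(\<lambda>x. (fst x, U (snd x))) ` hyp \<subseteq> hyp" using 1[OF U] by blast
    show "hyp \<subseteq> (\<lambda>x. (fst x, U (snd x))) ` hyp"
    proof
      fix x :: "real \<times> 'a" assume "x \<in> hyp"
      then have "(fst x, opinv U (snd x)) \<in> hyp" by (rule 1[OF orth_group_inv[OF U]])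
      moreover have "x = (\<lambda>x. (fst x, U (snd x))) (fst x, opinv U (snd x))"
        by (simp add: orth_group_inv_apply[OF U])
      ultimately show "x \<in> (\<lambda>x. (fst x, U (snd x))) ` hyp" by blast
    qed
  qed
  show "lform (fst x, U (snd x)) (fst y, U (snd y)) = lform x y" for x y
    using lin_isom_inner[OF orth_group_lin_isom[OF U]] by (simp add: lform_def)
qed

lemma rotation_compose:
  assumes "U \<in> orth_group" "V \<in> orth_group"
  shows "rotation (U \<circ> V) = compose hyp (rotation U) (rotation V)"
proof
  fix x
  show "rotation (U \<circ> V) x = compose hyp (rotation U) (rotation V) x"
  proof (cases "x \<in> hyp")
    case True
    then have "rotation V x \<in> hyp" by (rule hyp_isometryD(2)[OF rotation_isometry[OF assms(2)]])
    then show ?thesis using True by (simp add: compose_eq rotation_def)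
  qed (simp add: compose_def rotation_def)
qed

lemma rotation_id: "rotation id = (\<lambda>x\<in>hyp. x)"
  by (simp add: rotation_def)

lemma stabilizer_base_point:
  assumes g: "g \<in> hyp_isometries" "g base_point = base_point"
  obtains U where "U \<in> orth_group" "g = rotation U"
proof -
  let ?L = "linear_ext g"
  have Lb: "?L base_point = base_point"
    using linear_ext(4)[OF g(1) base_point_hyp] g(2) by simp
  have Lfst: "fst (?L x) = fst x" for x
    using linear_ext(2)[OF g(1), of x base_point] by (simp add: Lb lform_base_point)
  define U where "U h = snd (?L (0, h))" for h
  have L0: "?L (0, h) = (0, U h)" for h
    using Lfst[of "(0,h)"] by (simp add: U_def prod_eq_iff)
  have Lx: "?L x = (fst x, U (snd x))" for x
  proof -
    have "?L (fst x *\<^sub>R base_point + (0, snd x)) = fst x *\<^sub>R base_point + (0, U (snd x))"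
      by (simp only: linear_add[OF linear_ext(1)[OF g(1)]] linear_scale[OF linear_ext(1)[OF g(1)]] Lb L0)
    moreover have "fst x *\<^sub>R base_point + (0, snd x) = x"
      by (simp add: base_point_def prod_eq_iff)
    ultimately have "?L x = fst x *\<^sub>R base_point + (0, U (snd x))" by simp
    then show ?thesis by (simp add: base_point_def prod_eq_iff)
  qed
  have "linear U"
  proof (rule linearI)
    show "U (x + y) = U x + U y" for x y
      using linear_add[OF linear_ext(1)[OF g(1)], of "(0,x)" "(0,y)"] by (simp add: L0)
    show "U (c *\<^sub>R x) = c *\<^sub>R U x" for c x
      using linear_scale[OF linear_ext(1)[OF g(1)], of c "(0,x)"] by (simp add: L0)
  qed
  moreover have "norm (U h) = norm h" for h
    using linear_ext(2)[OF g(1), of "(0,h)" "(0,h)"] by (simp add: L0 lform_def norm_eq_sqrt_inner)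
  moreover have "surj U"
  proof -
    have "\<exists>k. h = U k" for h
    proof -
      obtain x where "x \<in> hyp" "?L x = (sqrt (1 + (norm h)\<^sup>2), h)"
        using linear_ext(3)[OF g(1)] hypI[of h] by (metis imageE)
      then show ?thesis by (auto simp: Lx)
    qed
    then show ?thesis by (auto simp: surj_def)
  qed
  ultimately have "U \<in> orth_group" by (simp add: orth_group_def lin_isom_def)
  moreover have "g = rotation U"
  proof
    fix x show "g x = rotation U x"
    proof (cases "x \<in> hyp")
      case True
      then show ?thesis using linear_ext(4)[OF g(1) True] by (simp add: Lx rotation_def)
    next
      case False
      then show ?thesis using extensional_arb[OF hyp_isometryD(4)[OF g(1)]] by (simp add: rotation_def)
    qed
  qed
  ultimately show ?thesis using that by blast
qed

section \<open>Distance-determined maps\<close>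

lemma (in separable_hilbert) unit_vector_orth_pair:
  fixes a b :: 'a
  obtains n :: 'a where "inner n n = 1" "inner n a = 0" "inner n b = 0"
proof -
  obtain e :: "nat \<Rightarrow> 'a" where e: "orthonormal e" "complete_fam e"
    using basis_exists[where 'i = nat] by auto
  obtain n where "norm n = 1" "\<And>f. f \<in> {a, b} \<Longrightarrow> inner n f = 0"
    by (rule unit_vector_orth[OF e(1), of "{a, b}"]) auto
  then show ?thesis using that[of n] by (simp add: norm_eq_1)
qed

text \<open>The apex \<open>w\<close> lies over the midpoint of \<open>u\<close> and \<open>v\<close>, in a direction \<open>n\<close> orthogonal to both.\<close>

lemma (in separable_hilbert) isosceles:
  fixes u v :: "real \<times> 'a"
  assumes u: "u \<in> hyp" and v: "v \<in> hyp" and c: "lform u v \<le> c"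
  obtains w where "w \<in> hyp" "lform u w = c" "lform w v = c"
proof -
  define L where "L = lform u v"
  have L: "1 \<le> L" "L \<le> c" using lform_ge_1[OF u v] c by (simp_all add: L_def)
  have uv: "lform u u = 1" "lform v v = 1" "lform u v = L" "lform v u = L"
    using u v by (auto simp: hyp_def L_def lform_commute)
  obtain h where h: "inner h h = 1" "inner h (snd u) = 0" "inner h (snd v) = 0"
    by (rule unit_vector_orth_pair)
  define n where "n = (0::real, h)"
  have n: "lform n n = -1" "lform n u = 0" "lform n v = 0" "lform u n = 0" "lform v n = 0"
    using h by (simp_all add: n_def lform_def inner_commute)
  define \<alpha> where "\<alpha> = c / (1 + L)"
  have ge: "2 * c\<^sup>2 / (1 + L) - 1 \<ge> 0"
  proof -
    have "c * 1 \<le> c * c" using L by (intro mult_left_mono) auto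
    then have "1 + L \<le> 2 * c\<^sup>2" using L unfolding power2_eq_square by linarith
    then show ?thesis using L by (simp add: field_simps)
  qed
  define \<beta> where "\<beta> = sqrt (2 * c\<^sup>2 / (1 + L) - 1)"
  have \<beta>: "\<beta> * \<beta> = 2 * c\<^sup>2 / (1 + L) - 1" using ge by (simp add: \<beta>_def)
  define w where "w = \<alpha> *\<^sub>R (u + v) + \<beta> *\<^sub>R n"
  have aL: "\<alpha> * (1 + L) = c" using L by (simp add: \<alpha>_def)
  have wu: "lform w u = c" "lform u w = c" "lform w v = c"
    using aL by (simp_all add: w_def lform_simps uv n algebra_simps)
  have "lform w w = 2 * \<alpha> * (\<alpha> * (1 + L)) - \<beta> * \<beta>"
    by (simp add: w_def lform_simps uv n algebra_simps)
  also have "\<dots> = 1"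
    unfolding aL \<beta> by (simp add: \<alpha>_def power2_eq_square)
  finally have "lform w w = 1" .
  then have "w \<in> hyp" using hyp_if_lform_pos[OF _ u, of w] wu(1) L by simp
  then show ?thesis using that wu by blast
qed

text \<open>No continuity is assumed: if all distances between the images of distinct points were at least
  \<open>e\<close>, separability would make the hyperboloid countable. This yields one positive distance that \<open>f\<close>
  contracts to less than \<open>e / 2\<close>, and all smaller distances are controlled by isosceles triangles.\<close>

lemma (in separable_hilbert) distance_determined_continuous:
  fixes f :: "real \<times> 'a \<Rightarrow> real \<times> 'a"
  assumes f: "\<And>x. x \<in> hyp \<Longrightarrow> f x \<in> hyp"
    and inv: "\<And>x y x' y'. x \<in> hyp \<Longrightarrow> y \<in> hyp \<Longrightarrow> x' \<in> hyp \<Longrightarrow> y' \<in> hyp \<Longrightarrow>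
      lform x y = lform x' y' \<Longrightarrow> lform (f x) (f y) = lform (f x') (f y')"
  shows "continuous_on hyp f"
proof -
  have small: "\<exists>x\<in>hyp. \<exists>y\<in>hyp. x \<noteq> y \<and> hdist (f x) (f y) < e" if e: "e > 0" for e
  proof (rule ccontr)
    assume "\<not> ?thesis"
    then have sep: "hdist (f x) (f y) \<ge> e" if "x \<in> hyp" "y \<in> hyp" "x \<noteq> y" for x y
      using that by force
    obtain r where r: "r > 0"
      "\<forall>x\<in>hyp. \<forall>y\<in>(hyp :: (real \<times> 'a) set). dist x y < r \<longrightarrow> hdist x y < e"
      using hdist_less_if_dist_less[OF e] by blast
    have "countable (\<rat> \<times> D)" using D(1) by (intro countable_SIGMA countable_rat)
    moreover have "closure (\<rat> \<times> D) = (UNIV :: (real \<times> 'a) set)"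
      by (simp add: closure_Times D(2) Rats_closure_real)
    ultimately have "countable (hyp :: (real \<times> 'a) set)"
    proof (rule countable_separated[OF _ _ r(1), where f = f])
      fix x y :: "real \<times> 'a" assume xy: "x \<in> hyp" "y \<in> hyp" "x \<noteq> y"
      show "r \<le> dist (f x) (f y)"
        using r(2) f[OF xy(1)] f[OF xy(2)] sep[OF xy] by (meson linorder_not_le)
    qed
    moreover obtain n :: 'a where n: "inner n n = 1" using unit_vector_orth_pair by blast
    ultimately have "countable ((\<lambda>x. inner (snd x) n) ` (hyp :: (real \<times> 'a) set))" by simp
    \<comment> \<open>A countable hyperboloid would have a countable projection to the line spanned by \<open>n\<close>.\<close>
    moreover have "t \<in> (\<lambda>x. inner (snd x) n) ` (hyp :: (real \<times> 'a) set)" for t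
    proof (rule image_eqI)
      show "(sqrt (1 + (norm (t *\<^sub>R n))\<^sup>2), t *\<^sub>R n) \<in> hyp" by (rule hypI)
    qed (simp add: n)
    then have "(\<lambda>x. inner (snd x) n) ` (hyp :: (real \<times> 'a) set) = UNIV" by blast
    ultimately show False using uncountable_UNIV_real by simp
  qed
  have modulus: "\<exists>\<delta>>0. \<forall>u\<in>hyp. \<forall>v\<in>hyp. hdist u v < \<delta> \<longrightarrow> hdist (f u) (f v) < e" if e: "e > 0" for e
  proof -
    obtain x y where xy: "x \<in> hyp" "y \<in> hyp" "x \<noteq> y" "hdist (f x) (f y) < e / 2"
      using small[of "e / 2"] e by auto
    have "hdist x y \<noteq> 0"
      using Metric_space.zero[OF Metric_space_hyp xy(1,2)] xy(3) by simp
    then have pos: "hdist x y > 0" using hdist_nonneg[of x y] by linarith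
    have "hdist (f u) (f v) < e" if u: "u \<in> hyp" and v: "v \<in> hyp" and d: "hdist u v < hdist x y" for u v
    proof -
      have "lform u v \<le> lform x y"
        using d hdist_less_iff[OF u v hdist_nonneg, of x y] cosh_hdist[OF xy(1,2)] by simp
      then obtain w where w: "w \<in> hyp" "lform u w = lform x y" "lform w v = lform x y"
        using isosceles[OF u v] by blast
      have "lform (f u) (f w) = lform (f x) (f y)" "lform (f w) (f v) = lform (f x) (f y)"
        using inv[OF u w(1) xy(1,2) w(2)] inv[OF w(1) v xy(1,2) w(3)] by simp_all
      then have "hdist (f u) (f w) = hdist (f x) (f y)" "hdist (f w) (f v) = hdist (f x) (f y)"
        using hdist_eq_iff[OF f[OF u] f[OF w(1)] f[OF xy(1)] f[OF xy(2)]]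
          hdist_eq_iff[OF f[OF w(1)] f[OF v] f[OF xy(1)] f[OF xy(2)]] by simp_all
      then show ?thesis
        using hdist_triangle[OF f[OF u] f[OF w(1)] f[OF v]] xy(4) by simp
    qed
    then show ?thesis using pos by blast
  qed
  show ?thesis
    unfolding continuous_on_iff
  proof (intro ballI allI impI)
    fix x :: "real \<times> 'a" and e :: real assume x: "x \<in> hyp" and e: "e > 0"
    obtain r where r: "r > 0" "\<forall>y\<in>hyp. hdist (f x) y < r \<longrightarrow> dist y (f x) < e"
      using dist_less_if_hdist_less[OF f[OF x] e] by blast
    obtain \<delta> where \<delta>: "\<delta> > 0" "\<forall>u\<in>hyp. \<forall>v\<in>hyp. hdist u v < \<delta> \<longrightarrow> hdist (f u) (f v) < r"
      using modulus[OF r(1)] by blast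
    obtain d where d: "d > 0" "\<forall>x\<in>hyp. \<forall>y\<in>(hyp :: (real \<times> 'a) set). dist x y < d \<longrightarrow> hdist x y < \<delta>"
      using hdist_less_if_dist_less[OF \<delta>(1)] by blast
    have "dist (f y) (f x) < e" if y: "y \<in> hyp" "dist y x < d" for y
    proof -
      have "hdist x y < \<delta>" using d(2) x y by (simp add: dist_commute)
      then have "hdist (f x) (f y) < r" using \<delta>(2) x y(1) by blast
      then show ?thesis using r(2) f[OF y(1)] by blast
    qed
    then show "\<exists>d>0. \<forall>x'\<in>hyp. dist x' x < d \<longrightarrow> dist (f x') (f x) < e" using d(1) by blast
  qed
qed

section \<open>The topology of the isometry group\<close>

lemma continuous_map_euclidean_iff:
  fixes F :: "'b \<Rightarrow> 'c::metric_space"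
  shows "continuous_map X euclidean F \<longleftrightarrow>
    (\<forall>x\<in>topspace X. \<forall>e>0. \<exists>U. openin X U \<and> x \<in> U \<and> (\<forall>y\<in>U. dist (F y) (F x) < e))"
  using Met_TC.continuous_map_to_metric[of X F]
  by (simp add: mtopology_is_euclidean dist_commute)

lemma continuous_map_eval:
  "x \<in> hyp \<Longrightarrow> continuous_map Is_topology (top_of_set hyp) (\<lambda>g. g x)"
  unfolding Is_topology_def hyp_topology_eq
  by (intro continuous_map_from_subtopology continuous_map_product_projection)

lemma continuous_map_into_Is:
  assumes "F \<in> topspace X \<rightarrow> hyp_isometries"
    and "\<And>x. x \<in> hyp \<Longrightarrow> continuous_map X (top_of_set hyp) (\<lambda>t. F t x)"
  shows "continuous_map X Is_topology F"
proof -
  have "F ` topspace X \<subseteq> extensional hyp"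
    using assms(1) hyp_isometryD(4) by blast
  then have "continuous_map X (product_topology (\<lambda>_. top_of_set hyp) hyp) F"
    using assms(2) unfolding continuous_map_componentwise by blast
  then show ?thesis
    using assms(1) unfolding Is_topology_def hyp_topology_eq
    by (simp only: continuous_map_in_subtopology[of X "product_topology (\<lambda>_. top_of_set hyp) hyp"])
qed

lemma topspace_Is: "topspace Is_topology = hyp_isometries"
  by (simp add: topspace_Is_topology Is_group_simps)

lemma continuous_map_right_mult:
  assumes h: "h \<in> hyp_isometries"
  shows "continuous_map Is_topology Is_topology (\<lambda>g. compose hyp g h)"
proof (rule continuous_map_into_Is)
  show "(\<lambda>g. compose hyp g h) \<in> topspace Is_topology \<rightarrow> hyp_isometries"
    using compose_isometry[OF _ h] by (auto simp: topspace_Is)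
  show "continuous_map Is_topology (top_of_set hyp) (\<lambda>g. compose hyp g h x)" if "x \<in> hyp" for x
    using continuous_map_eval[OF hyp_isometryD(2)[OF h that]] that by (simp add: compose_eq)
qed

lemma inverse_isometry:
  assumes "g \<in> hyp_isometries"
  obtains g' where "g' \<in> hyp_isometries" "compose hyp g' g = (\<lambda>x\<in>hyp. x)" "compose hyp g g' = (\<lambda>x\<in>hyp. x)"
proof -
  interpret group Is_group by (rule group_Is_group)
  have "inv\<^bsub>Is_group\<^esub> g \<in> hyp_isometries"
    using inv_closed[of g] assms by (simp add: Is_group_simps)
  then show ?thesis
    using that[of "inv\<^bsub>Is_group\<^esub> g"] l_inv[of g] r_inv[of g] assms by (simp add: Is_group_simps)
qed

section \<open>Self-representations\<close>

text \<open>A homomorphism of abstract groups, without any continuity assumption.\<close>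

locale self_representation = separable_hilbert D
  for D :: "'h::{real_inner,complete_space} set" +
  fixes \<rho> :: "(real \<times> 'h \<Rightarrow> real \<times> 'h) \<Rightarrow> (real \<times> 'h \<Rightarrow> real \<times> 'h)"
  assumes hom: "\<rho> \<in> hom Is_group Is_group"
begin

lemma rho_isometry: "g \<in> hyp_isometries \<Longrightarrow> \<rho> g \<in> hyp_isometries"
  using hom_in_carrier[OF hom, of g] by (simp add: Is_group_simps)

lemma rho_compose:
  assumes "g \<in> hyp_isometries" "h \<in> hyp_isometries"
  shows "\<rho> (compose hyp g h) = compose hyp (\<rho> g) (\<rho> h)"
  using hom_mult[OF hom, of g h] assms rho_isometry by (simp add: Is_group_simps)

lemma rho_apply:
  assumes "g \<in> hyp_isometries" "h \<in> hyp_isometries" "x \<in> hyp"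
  shows "\<rho> (compose hyp g h) x = \<rho> g (\<rho> h x)"
  using rho_compose[OF assms(1,2)] assms(3) by (simp add: compose_eq)

lemma rho_id: "x \<in> hyp \<Longrightarrow> \<rho> (\<lambda>x\<in>hyp. x) x = x"
  using hom_one[OF hom group_Is_group group_Is_group] by (simp add: Is_group_simps)

lemma rho_rotation_inv:
  assumes "U \<in> orth_group" "x \<in> hyp"
  shows "\<rho> (rotation (opinv U)) (\<rho> (rotation U) x) = x"
    "\<rho> (rotation U) (\<rho> (rotation (opinv U)) x) = x"
proof -
  note V = orth_group_inv[OF assms(1)]
  have "opinv U \<circ> U = id" "U \<circ> opinv U = id"
    by (simp_all add: fun_eq_iff orth_group_inv_apply[OF assms(1)])
  then show "\<rho> (rotation (opinv U)) (\<rho> (rotation U) x) = x"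
    "\<rho> (rotation U) (\<rho> (rotation (opinv U)) x) = x"
    using rho_apply[OF rotation_isometry[OF V] rotation_isometry[OF assms(1)] assms(2)]
      rho_apply[OF rotation_isometry[OF assms(1)] rotation_isometry[OF V] assms(2)]
      rotation_compose[OF V assms(1)] rotation_compose[OF assms(1) V] rho_id[OF assms(2)]
    by (simp_all add: rotation_id)
qed

lemma rotations_fixed_point:
  obtains p where "p \<in> hyp" "\<forall>U\<in>orth_group. \<rho> (rotation U) p = p"
proof -
  define l where "l U = hdist (\<rho> (rotation U) base_point) base_point" for U :: "'h \<Rightarrow> 'h"
  let ?r = "\<lambda>U. \<rho> (rotation U)"
  have r: "?r U \<in> hyp_isometries" "?r U base_point \<in> hyp" if "U \<in> orth_group" for U
    using rho_isometry[OF rotation_isometry[OF that]]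
      hyp_isometryD(2)[OF rho_isometry[OF rotation_isometry[OF that]] base_point_hyp] by simp_all
  have comp: "?r (U \<circ> V) x = ?r U (?r V x)" if "U \<in> orth_group" "V \<in> orth_group" "x \<in> hyp" for U V x
    using rho_apply[OF rotation_isometry[OF that(1)] rotation_isometry[OF that(2)] that(3)]
      rotation_compose[OF that(1,2)] by simp
  interpret separable_hilbert_length D l
  proof unfold_locales
    fix U V :: "'h \<Rightarrow> 'h" assume U: "U \<in> orth_group"
    show "0 \<le> l U" by (simp add: l_def hdist_nonneg)
    show "l (opinv U) \<le> l U"
      using hyp_isometryD(5)[OF r(1)[OF U] r(2)[OF orth_group_inv[OF U]] base_point_hyp]
      by (simp add: l_def rho_rotation_inv[OF U base_point_hyp] hdist_commute)
    assume V: "V \<in> orth_group"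
    have "l (U \<circ> V) \<le> hdist (?r U (?r V base_point)) (?r U base_point) + l U"
      unfolding l_def comp[OF U V base_point_hyp]
      by (intro hdist_triangle hyp_isometryD(2)[OF r(1)] r(2) U V base_point_hyp)
    then show "l (U \<circ> V) \<le> l U + l V"
      using hyp_isometryD(5)[OF r(1)[OF U] r(2)[OF V] base_point_hyp] by (simp add: l_def)
  qed
  obtain M where M: "\<forall>U\<in>orth_group. l U \<le> M" using length_bounded by (rule exE)
  define S where "S = (\<lambda>U. ?r U base_point) ` orth_group"
  have Sh: "S \<subseteq> hyp" using r(2) by (auto simp: S_def)
  have "S \<noteq> {}" using orth_group_id by (auto simp: S_def)
  have bound: "fst s \<le> cosh M" if "s \<in> S" for s
  proof -
    obtain U where U: "U \<in> orth_group" "s = ?r U base_point" using \<open>s \<in> S\<close> by (auto simp: S_def)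
    have "fst s = cosh (l U)"
      using cosh_hdist[OF r(2)[OF U(1)] base_point_hyp] by (simp add: l_def U(2) lform_base_point)
    also have "0 \<le> l U" "l U \<le> M" using U(1) M by (auto simp: l_def hdist_nonneg)
    then have "cosh (l U) \<le> cosh M" using cosh_real_nonneg_le_iff[of "l U" M] by simp
    finally show ?thesis .
  qed
  obtain p where p: "p \<in> hyp" "\<forall>f\<in>hyp_isometries. f ` S = S \<longrightarrow> f p = p"
    using circumcenter[OF Sh \<open>S \<noteq> {}\<close> bound] by blast
  have sub: "?r U ` S \<subseteq> S" if U: "U \<in> orth_group" for U
  proof
    fix y assume "y \<in> ?r U ` S"
    then obtain V where V: "V \<in> orth_group" "y = ?r U (?r V base_point)" by (auto simp: S_def)
    then have "y = ?r (U \<circ> V) base_point" using comp[OF U V(1) base_point_hyp] by simp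
    then show "y \<in> S" unfolding S_def using orth_group_compose[OF U V(1)] by blast
  qed
  have "?r U p = p" if U: "U \<in> orth_group" for U
  proof -
    have "S \<subseteq> ?r U ` S"
    proof
      fix s assume s: "s \<in> S"
      then have "?r (opinv U) s \<in> S" using sub[OF orth_group_inv[OF U]] by blast
      moreover have "s = ?r U (?r (opinv U) s)"
        using rho_rotation_inv(2)[OF U, of s] s Sh by auto
      ultimately show "s \<in> ?r U ` S" by (rule rev_image_eqI)
    qed
    then have "?r U ` S = S" using sub[OF U] by blast
    then show ?thesis using p(2) r(1)[OF U] by blast
  qed
  then show ?thesis using that p(1) by blast
qed

text \<open>The map \<open>g o \<mapsto> \<rho>(g) p\<close>, where \<open>o\<close> is the base point and \<open>p\<close> is fixed by the image of its
  stabilizer.\<close>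

lemma equivariant_map:
  obtains f where "f ` hyp \<subseteq> hyp" "\<forall>g\<in>hyp_isometries. \<forall>x\<in>hyp. f (g x) = \<rho> g (f x)"
proof -
  obtain p where p: "p \<in> hyp" "\<forall>U\<in>orth_group. \<rho> (rotation U) p = p"
    by (rule rotations_fixed_point)
  have wd: "\<rho> g p = \<rho> h p"
    if g: "g \<in> hyp_isometries" and h: "h \<in> hyp_isometries" and gh: "g base_point = h base_point" for g h
  proof -
    obtain g' where g': "g' \<in> hyp_isometries" "compose hyp g' g = (\<lambda>x\<in>hyp. x)" "compose hyp g g' = (\<lambda>x\<in>hyp. x)"
      using inverse_isometry[OF g] by blast
    let ?k = "compose hyp g' h"
    have k: "?k \<in> hyp_isometries" by (rule compose_isometry[OF g'(1) h])
    have "?k base_point = compose hyp g' g base_point"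
      by (simp add: compose_eq base_point_hyp gh)
    then have "?k base_point = base_point" by (simp add: g'(2) base_point_hyp)
    then obtain U where U: "U \<in> orth_group" "?k = rotation U"
      using stabilizer_base_point[OF k] by blast
    have "\<rho> g (\<rho> ?k p) = \<rho> (compose hyp g ?k) p" by (rule rho_apply[OF g k p(1), symmetric])
    also have "compose hyp g ?k = h"
    proof
      fix x show "compose hyp g ?k x = h x"
      proof (cases "x \<in> hyp")
        case True
        then have hx: "h x \<in> hyp" by (rule hyp_isometryD(2)[OF h])
        have "compose hyp g ?k x = compose hyp g g' (h x)" using True hx by (simp add: compose_eq)
        then show ?thesis by (simp add: g'(3) hx)
      next
        case False
        then show ?thesis using extensional_arb[OF hyp_isometryD(4)[OF h]] by (simp add: compose_def)
      qed
    qed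
    finally show ?thesis using p(2) U by simp
  qed
  define f where "f x = \<rho> (SOME g. g \<in> hyp_isometries \<and> g base_point = x) p" for x
  have f: "f (g base_point) = \<rho> g p" if g: "g \<in> hyp_isometries" for g
  proof -
    let ?P = "\<lambda>h. h \<in> hyp_isometries \<and> h base_point = g base_point"
    have "?P (Eps ?P)" by (rule someI[of ?P g]) (use g in simp)
    then show ?thesis unfolding f_def using wd[of "Eps ?P" g] g by blast
  qed
  have trans: "\<exists>g\<in>hyp_isometries. g base_point = x" if "x \<in> hyp" for x
    using hyp_swap[OF base_point_hyp that] by blast
  show ?thesis
  proof (rule that[of f])
    have "f x \<in> hyp" if x: "x \<in> hyp" for x
    proof -
      obtain g where "g \<in> hyp_isometries" "g base_point = x" using trans[OF x] by blast
      then show ?thesis using f[of g] hyp_isometryD(2)[OF rho_isometry[of g] p(1)] by simp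
    qed
    then show "f ` hyp \<subseteq> hyp" by blast
    show "\<forall>g\<in>hyp_isometries. \<forall>x\<in>hyp. f (g x) = \<rho> g (f x)"
    proof (intro ballI)
      fix g :: "real \<times> 'h \<Rightarrow> real \<times> 'h" and x :: "real \<times> 'h"
      assume g: "g \<in> hyp_isometries" and x: "x \<in> hyp"
      obtain h where h: "h \<in> hyp_isometries" "h base_point = x" using trans[OF x] by blast
      have "f (g x) = f (compose hyp g h base_point)" using h by (simp add: compose_eq base_point_hyp)
      also have "\<dots> = \<rho> g (\<rho> h p)"
        using f[OF compose_isometry[OF g h(1)]] rho_apply[OF g h(1) p(1)] by simp
      also have "\<rho> h p = f x" using f[OF h(1)] h(2) by simp
      finally show "f (g x) = \<rho> g (f x)" .
    qed
  qed
qed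

text \<open>The operator norm of \<open>\<rho> h\<close> is bounded in terms of \<open>fst (\<rho> h p)\<close>, which is locally bounded in \<open>h\<close>. So the
  orbit map of \<open>v\<close> is locally a uniform limit of continuous orbit maps.\<close>

lemma linear_orbit_map_closed:
  assumes p: "p \<in> hyp" and cp: "continuous_map Is_topology euclidean (\<lambda>g. \<rho> g p)"
    and v: "v \<in> closure {v. continuous_map Is_topology euclidean (\<lambda>g. linear_ext (\<rho> g) v)}"
  shows "continuous_map Is_topology euclidean (\<lambda>g. linear_ext (\<rho> g) v)"
  unfolding continuous_map_euclidean_iff
proof (intro ballI allI impI)
  fix g :: "real \<times> 'h \<Rightarrow> real \<times> 'h" and e :: real assume "g \<in> topspace Is_topology" and e: "e > 0"
  then have g: "g \<in> hyp_isometries" by (simp add: topspace_Is)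
  define B where "B = 12 * fst p * (fst (\<rho> g p) + 1)"
  have gp: "\<rho> g p \<in> hyp" by (rule hyp_isometryD(2)[OF rho_isometry[OF g] p])
  have p1: "fst p \<ge> 1" by (rule hyp_sq(2)[OF p])
  have B: "B > 0" using p1 hyp_sq(2)[OF gp] by (simp add: B_def)
  obtain w where w: "continuous_map Is_topology euclidean (\<lambda>g. linear_ext (\<rho> g) w)" "dist w v < e / (3 * B)"
  proof -
    have "e / (3 * B) > 0" using e B by simp
    then show ?thesis using v that unfolding closure_approachable by blast
  qed
  obtain U where U: "openin Is_topology U" "g \<in> U" "\<forall>h\<in>U. dist (\<rho> h p) (\<rho> g p) < 1"
    using cp g zero_less_one unfolding continuous_map_euclidean_iff topspace_Is by blast
  obtain V where V: "openin Is_topology V" "g \<in> V"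
    "\<forall>h\<in>V. dist (linear_ext (\<rho> h) w) (linear_ext (\<rho> g) w) < e / 3"
  proof -
    have "e / 3 > 0" using e by simp
    then show ?thesis using w(1) g that unfolding continuous_map_euclidean_iff topspace_Is by blast
  qed
  have bd: "norm (linear_ext (\<rho> h) (v - w)) < e / 3" if h: "h \<in> U" for h
  proof -
    have hI: "h \<in> hyp_isometries" using openin_subset[OF U(1)] h by (auto simp: topspace_Is)
    note rh = rho_isometry[OF hI]
    have "\<bar>fst (\<rho> h p) - fst (\<rho> g p)\<bar> \<le> dist (\<rho> h p) (\<rho> g p)"
      using dist_fst_le[of "\<rho> h p" "\<rho> g p"] by (simp add: dist_real_def)
    then have "fst (\<rho> h p) \<le> fst (\<rho> g p) + 1" using U(3) h by fastforce
    have "fst (\<rho> h base_point) \<le> 2 * fst (\<rho> h p) * lform (\<rho> h p) (\<rho> h base_point)"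
      by (intro hyp_fst_bound hyp_isometryD(2)[OF rh] p base_point_hyp)
    also have "lform (\<rho> h p) (\<rho> h base_point) = fst p"
      using hyp_isometryD(6)[OF rh p base_point_hyp] by (simp add: lform_base_point)
    also have "2 * fst (\<rho> h p) * fst p \<le> 2 * (fst (\<rho> g p) + 1) * fst p"
      using \<open>fst (\<rho> h p) \<le> fst (\<rho> g p) + 1\<close> p1 by (intro mult_right_mono mult_left_mono) auto
    finally have "fst (\<rho> h base_point) \<le> 2 * (fst (\<rho> g p) + 1) * fst p" .
    moreover have "B = 6 * (2 * (fst (\<rho> g p) + 1) * fst p)" by (simp add: B_def)
    ultimately have "6 * fst (\<rho> h base_point) \<le> B" by linarith
    then have "6 * fst (\<rho> h base_point) * norm (v - w) \<le> B * norm (v - w)"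
      by (rule mult_right_mono) simp
    moreover have "B * norm (v - w) < e / 3"
      using w(2) B by (simp add: dist_norm norm_minus_commute field_simps)
    ultimately show ?thesis using linear_ext_norm_bound[OF rh, of "v - w"] by linarith
  qed
  have "dist (linear_ext (\<rho> h) v) (linear_ext (\<rho> g) v) < e" if h: "h \<in> U \<inter> V" for h
  proof -
    have hI: "h \<in> hyp_isometries" using openin_subset[OF U(1)] h by (auto simp: topspace_Is)
    have split: "linear_ext (\<rho> k) v = linear_ext (\<rho> k) (v - w) + linear_ext (\<rho> k) w"
      if "k \<in> hyp_isometries" for k
      using linear_add[OF linear_ext(1)[OF rho_isometry[OF that]], of "v - w" w] by simp
    have "dist (linear_ext (\<rho> h) v) (linear_ext (\<rho> g) v)
        = norm (linear_ext (\<rho> h) (v - w) - linear_ext (\<rho> g) (v - w)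
          + (linear_ext (\<rho> h) w - linear_ext (\<rho> g) w))"
      unfolding dist_norm split[OF hI] split[OF g] by (simp add: algebra_simps)
    also have "\<dots> \<le> norm (linear_ext (\<rho> h) (v - w)) + norm (linear_ext (\<rho> g) (v - w))
        + norm (linear_ext (\<rho> h) w - linear_ext (\<rho> g) w)"
      by (rule order_trans[OF norm_triangle_ineq add_right_mono[OF norm_triangle_ineq4]])
    also have "\<dots> < e / 3 + e / 3 + e / 3"
      using bd[of h] bd[OF U(2)] V(3) h by (intro add_strict_mono) (auto simp: dist_norm)
    finally show ?thesis by simp
  qed
  then show "\<exists>W. openin Is_topology W \<and> g \<in> W \<and>
      (\<forall>h\<in>W. dist (linear_ext (\<rho> h) v) (linear_ext (\<rho> g) v) < e)"
    using openin_Int[OF U(1) V(1)] U(2) V(2) by (intro exI[of _ "U \<inter> V"]) blast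
qed

theorem irreducible_continuous:
  assumes irr: "irreducible_rep Is_group \<rho>"
  shows "continuous_map Is_topology Is_topology \<rho>"
proof -
  obtain f where f0: "f ` hyp \<subseteq> hyp" "\<forall>g\<in>hyp_isometries. \<forall>x\<in>hyp. f (g x) = \<rho> g (f x)"
    by (rule equivariant_map)
  then have f: "x \<in> hyp \<Longrightarrow> f x \<in> hyp" "g \<in> hyp_isometries \<Longrightarrow> x \<in> hyp \<Longrightarrow> f (g x) = \<rho> g (f x)" for g x
    by blast+
  have fc: "continuous_on hyp f"
  proof (rule distance_determined_continuous[OF f(1)])
    fix x y x' y' :: "real \<times> 'h"
    assume *: "x \<in> hyp" "y \<in> hyp" "x' \<in> hyp" "y' \<in> hyp" "lform x y = lform x' y'"
    then obtain g where g: "g \<in> hyp_isometries" "g x = x'" "g y = y'"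
      using two_point_homogeneous[OF *] by blast
    then show "lform (f x) (f y) = lform (f x') (f y')"
      using hyp_isometryD(6)[OF rho_isometry[OF g(1)] f(1)[OF *(1)] f(1)[OF *(2)]]
        f(2)[OF g(1) *(1)] f(2)[OF g(1) *(2)] by simp
  qed
  define p where "p = f base_point"
  have p: "p \<in> hyp" unfolding p_def by (rule f(1)[OF base_point_hyp])
  have cp: "continuous_map Is_topology euclidean (\<lambda>g. \<rho> g p)"
  proof (rule continuous_map_eq)
    have "continuous_map (top_of_set hyp) euclidean f" using fc by simp
    then show "continuous_map Is_topology euclidean (f \<circ> (\<lambda>g. g base_point))"
      by (rule continuous_map_compose[OF continuous_map_eval[OF base_point_hyp]])
    show "(f \<circ> (\<lambda>g. g base_point)) g = \<rho> g p" if "g \<in> topspace Is_topology" for g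
      using f(2)[of g base_point] that base_point_hyp by (simp add: topspace_Is p_def)
  qed
  define C where "C = {v. continuous_map Is_topology euclidean (\<lambda>g. linear_ext (\<rho> g) v)}"
  have lin: "linear (linear_ext (\<rho> g))" if "g \<in> topspace Is_topology" for g
    using that linear_ext(1)[OF rho_isometry] by (simp add: topspace_Is)
  have "subspace C"
  proof (rule subspaceI)
    have "continuous_map Is_topology euclidean (\<lambda>g. linear_ext (\<rho> g) 0)"
      by (rule continuous_map_eq[of _ _ "\<lambda>_. 0"]) (simp_all add: linear_0 lin)
    then show "0 \<in> C" by (simp add: C_def)
    fix x y c assume x: "x \<in> C"
    show "c *\<^sub>R x \<in> C"
    proof -
      have "continuous_map euclidean euclidean ((*\<^sub>R) c :: real \<times> 'h \<Rightarrow> real \<times> 'h)"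
        by (simp add: continuous_intros)
      then have "continuous_map Is_topology euclidean ((*\<^sub>R) c \<circ> (\<lambda>g. linear_ext (\<rho> g) x))"
        using x by (intro continuous_map_compose[of _ euclidean]) (simp_all add: C_def)
      then have "continuous_map Is_topology euclidean (\<lambda>g. linear_ext (\<rho> g) (c *\<^sub>R x))"
        by (rule continuous_map_eq) (simp add: linear_scale lin)
      then show ?thesis by (simp add: C_def)
    qed
    assume y: "y \<in> C"
    have "continuous_map Is_topology euclidean (\<lambda>g. linear_ext (\<rho> g) x + linear_ext (\<rho> g) y)"
      using x y by (intro continuous_map_add) (simp_all add: C_def)
    then have "continuous_map Is_topology euclidean (\<lambda>g. linear_ext (\<rho> g) (x + y))"
      by (rule continuous_map_eq) (simp add: linear_add lin)
    then show "x + y \<in> C" by (simp add: C_def)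
  qed
  moreover have "closed C"
    using linear_orbit_map_closed[OF p cp] closure_subset_eq[of C] unfolding C_def by blast
  moreover have "linear_ext (\<rho> h) ` C \<subseteq> C" if "h \<in> carrier Is_group" for h
  proof
    have h: "h \<in> hyp_isometries" using that by (simp add: Is_group_simps)
    fix y assume "y \<in> linear_ext (\<rho> h) ` C"
    then obtain v where v: "v \<in> C" "y = linear_ext (\<rho> h) v" by blast
    have "continuous_map Is_topology euclidean ((\<lambda>g. linear_ext (\<rho> g) v) \<circ> (\<lambda>g. compose hyp g h))"
      using v(1) by (intro continuous_map_compose[OF continuous_map_right_mult[OF h]]) (simp add: C_def)
    then have "continuous_map Is_topology euclidean (\<lambda>g. linear_ext (\<rho> g) y)"
      by (rule continuous_map_eq)
        (simp add: topspace_Is rho_compose h v(2) linear_ext_compose rho_isometry)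
    then show "y \<in> C" by (simp add: C_def)
  qed
  ultimately have "C = {0} \<or> C = UNIV"
    using irr unfolding irreducible_rep_def by blast
  moreover have "p \<in> C"
  proof -
    have "continuous_map Is_topology euclidean (\<lambda>g. linear_ext (\<rho> g) p)"
      by (rule continuous_map_eq[OF cp]) (simp add: topspace_Is linear_ext(4) rho_isometry p)
    then show ?thesis by (simp add: C_def)
  qed
  moreover have "p \<noteq> 0" using hyp_sq(2)[OF p] by auto
  ultimately have C: "C = UNIV" by blast
  show ?thesis
  proof (rule continuous_map_into_Is)
    show "\<rho> \<in> topspace Is_topology \<rightarrow> hyp_isometries"
      using rho_isometry by (auto simp: topspace_Is)
    fix x :: "real \<times> 'h" assume x: "x \<in> hyp"
    have "continuous_map Is_topology euclidean (\<lambda>g. linear_ext (\<rho> g) x)" using C by (auto simp: C_def)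
    then have "continuous_map Is_topology euclidean (\<lambda>g. \<rho> g x)"
      by (rule continuous_map_eq) (simp add: topspace_Is linear_ext(4) rho_isometry x)
    then show "continuous_map Is_topology (top_of_set hyp) (\<lambda>g. \<rho> g x)"
      using x hyp_isometryD(2)[OF rho_isometry] by (auto simp: continuous_map_in_subtopology topspace_Is)
  qed
qed

end

theorem theorem3:
  fixes \<rho> :: "(real \<times> 'h::{real_inner, complete_space} \<Rightarrow> real \<times> 'h)
               \<Rightarrow> (real \<times> 'h \<Rightarrow> real \<times> 'h)"
  assumes "separable_space (euclidean :: 'h topology)"
    and "\<not> (\<exists>S :: 'h set. finite S \<and> span S = UNIV)"
    and "\<rho> \<in> hom Is_group Is_group"
    and "irreducible_rep Is_group \<rho>"
  shows "continuous_map Is_topology Is_topology \<rho>"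
proof -
  obtain D :: "'h set" where D: "countable D" "closure D = UNIV"
    using assms(1) by (auto simp: separable_space_def)
  interpret self_representation D \<rho>
    by unfold_locales (fact D assms)+
  show ?thesis by (rule irreducible_continuous[OF assms(4)])
qed

end
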